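(* With the notation of the context, the following equality of (virtual) 3-sort species holds: \[ \mathcal G_{\neq 2}(X, X+Y, Z) = \mathcal M\circ\mathcal P - XY - \mathcal E_2(Z). \]
   Context: A (combinatorial) species is a functor from finite sets with bijections to finite sets with bijections; a $k$-sort species is a functor from $k$-tuples of finite sets with sort-preserving bijections to finite sets with bijections; species are equal if naturally isomorphic, and virtual species are formal differences of species. Sum: $(F+G)[U]=F[U]\sqcup G[U]$; product: $(F\cdot G)[U]=\bigsqcup_{U=V+W}F[V]\times G[W]$ over ordered decompositions into disjoint (possibly empty) parts (componentwise for $k$-tuples); composition of a 1-sort $F$ with a $k$-sort $G$ satisfying $G[\emptyset]=0$: $(F\circ G)[U]=\bigsqcup_{\pi}F[\pi]\times\prod_{B\in\pi}G[B]$ over partitions $\pi$ of the $k$-set $U$ into blocks that are nonempty $k$-tuples; multisort substitution $F(G_1,\dots,G_k)$ is defined analogously; all operations extend to virtual species. $X,Y,Z$ denote the singleton species of three different sorts, $\mathcal E$ the species of sets (one structure on every set), $\mathcal E_n$ its restriction to sets of size $n$, $\mathcal E_{\geq m}$ to sizes $\geq m$. Graphs are finite and simple; a leaf is a vertex of degree $1$; two distinct vertices are siblings if they have equal closed neighborhoods $N[v]=\{v\}\cup N(v)$. $\mathcal M$ is the 1-sort species of co-mating graphs: $\mathcal M[U]$ is the set of connected graphs with vertex set $U$ having no siblings. $\mathcal G_{\neq 2}(X,Y,Z)$ is the 3-sort species with $\mathcal G_{\neq 2}[(U_1,U_2,U_3)]$ the set of connected graphs on $U_1\sqcup U_2\sqcup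 U_3$ such that $U_2$ is exactly the set of leaves, $U_3$ exactly the set of vertices having a sibling, and $U_1$ the remaining vertices. Thus $\mathcal G_{\neq2}(X,X+Y,Z)$ has as structures on $(U_1,U_2,U_3)$ the connected graphs on $U_1\sqcup U_2\sqcup U_3$ in which $U_3$ is exactly the set of vertices with siblings, every vertex of $U_2$ is a leaf, and $U_1$ contains all other vertices (leaves may lie in $U_1$ or $U_2$). The species of tufts is $\mathcal T(X,Y)=X\,\mathcal E_{\geq1}(Y)$, and the species of patches is $\mathcal P(X,Y,Z)=\big(1+X+\mathcal E_{\geq 2}(Z)\big)\cdot(\mathcal E\circ\mathcal T)-1$, where $1=\mathcal E_0$. *)

theory Defs
  imports Main
begin

section \<open>3-sort finite sets (labels of an arbitrary type 'a)\<close>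

type_synonym 'a tri = "'a set \<times> 'a set \<times> 'a set"

definition s1 :: "'a tri \<Rightarrow> 'a set" where "s1 U = fst U"
definition s2 :: "'a tri \<Rightarrow> 'a set" where "s2 U = fst (snd U)"
definition s3 :: "'a tri \<Rightarrow> 'a set" where "s3 U = snd (snd U)"

text \<open>underlying set U1 + U2 + U3\<close>
definition tset :: "'a tri \<Rightarrow> 'a set" where "tset U = s1 U \<union> s2 U \<union> s3 U"

definition tri_ok :: "'a tri \<Rightarrow> bool" where
  "tri_ok U \<longleftrightarrow> finite (tset U) \<and> s1 U \<inter> s2 U = {} \<and> s1 U \<inter> s3 U = {} \<and> s2 U \<inter> s3 U = {}"

text \<open>transport along a sort-preserving bijection sigma (injective on tset U)\<close>
definition tri_img :: "('a \<Rightarrow> 'a) \<Rightarrow> 'a tri \<Rightarrow> 'a tri" where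
  "tri_img \<sigma> U = (\<sigma> ` s1 U, \<sigma> ` s2 U, \<sigma> ` s3 U)"

definition tri_sub :: "'a tri \<Rightarrow> 'a tri \<Rightarrow> bool" where
  "tri_sub W U \<longleftrightarrow> s1 W \<subseteq> s1 U \<and> s2 W \<subseteq> s2 U \<and> s3 W \<subseteq> s3 U"

definition tri_diff :: "'a tri \<Rightarrow> 'a tri \<Rightarrow> 'a tri" where
  "tri_diff U W = (s1 U - s1 W, s2 U - s2 W, s3 U - s3 W)"

text \<open>partitions of a 3-set into blocks that are nonempty 3-sets\<close>
definition tri_partition :: "'a tri set \<Rightarrow> 'a tri \<Rightarrow> bool" where
  "tri_partition \<pi> U \<longleftrightarrow> finite \<pi> \<and>
     (\<forall>B\<in>\<pi>. tri_sub B U \<and> tset B \<noteq> {}) \<and>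
     (\<forall>B\<in>\<pi>. \<forall>B'\<in>\<pi>. B \<noteq> B' \<longrightarrow> tset B \<inter> tset B' = {}) \<and>
     \<Union>(s1 ` \<pi>) = s1 U \<and> \<Union>(s2 ` \<pi>) = s2 U \<and> \<Union>(s3 ` \<pi>) = s3 U"

section \<open>Simple graphs: a vertex set W and a set E of 2-element edges\<close>

definition graph_on :: "'v set \<Rightarrow> 'v set set \<Rightarrow> bool" where
  "graph_on W E \<longleftrightarrow> finite W \<and> (\<forall>e\<in>E. e \<subseteq> W \<and> card e = 2)"

definition nbhd :: "'v set set \<Rightarrow> 'v \<Rightarrow> 'v set" where
  "nbhd E v = {u. {u, v} \<in> E}"

definition cnbhd :: "'v set set \<Rightarrow> 'v \<Rightarrow> 'v set" where
  "cnbhd E v = insert v (nbhd E v)"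

definition is_leaf :: "'v set set \<Rightarrow> 'v \<Rightarrow> bool" where
  "is_leaf E v \<longleftrightarrow> card (nbhd E v) = 1"

definition has_sibling :: "'v set \<Rightarrow> 'v set set \<Rightarrow> 'v \<Rightarrow> bool" where
  "has_sibling W E v \<longleftrightarrow> (\<exists>u\<in>W. u \<noteq> v \<and> cnbhd E u = cnbhd E v)"

definition connected_graph :: "'v set \<Rightarrow> 'v set set \<Rightarrow> bool" where
  "connected_graph W E \<longleftrightarrow> graph_on W E \<and> W \<noteq> {} \<and>
     (\<forall>u\<in>W. \<forall>v\<in>W. (u, v) \<in> {(x, y). {x, y} \<in> E}\<^sup>*)"

section \<open>The species involved (structure sets on a 3-set U, plus transport)\<close>

text \<open>co-mating graphs M (1-sort): connected graphs without siblings\<close>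
definition M_sp :: "'v set \<Rightarrow> 'v set set set" where
  "M_sp W = {E. connected_graph W E \<and> (\<forall>v\<in>W. \<not> has_sibling W E v)}"

text \<open>G_{\<noteq>2}(X,Y,Z)\<close>
definition Gne2 :: "'a tri \<Rightarrow> 'a set set set" where
  "Gne2 U = {E. connected_graph (tset U) E \<and>
               s2 U = {v\<in>tset U. is_leaf E v} \<and>
               s3 U = {v\<in>tset U. has_sibling (tset U) E v}}"

text \<open>the substitution G_{\<noteq>2}(X, X+Y, Z): every label of sort 1 becomes a vertex of sort 1
  (via X) or of sort 2 (via the summand X of X+Y); A is the set of the latter.\<close>
definition GXXYZ :: "'a tri \<Rightarrow> ('a set \<times> 'a set set) set" where
  "GXXYZ U = {(A, E). A \<subseteq> s1 U \<and> E \<in> Gne2 (s1 U - A, A \<union> s2 U, s3 U)}"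

definition XY_sp :: "'a tri \<Rightarrow> unit set" where
  "XY_sp U = (if card (s1 U) = 1 \<and> card (s2 U) = 1 \<and> s3 U = {} then {()} else {})"

definition E2Z_sp :: "'a tri \<Rightarrow> unit set" where
  "E2Z_sp U = (if s1 U = {} \<and> s2 U = {} \<and> card (s3 U) = 2 then {()} else {})"

text \<open>left-hand side of the (cancelled) identity: G_{\<noteq>2}(X,X+Y,Z) + XY + E_2(Z)\<close>
type_synonym 'a lhs_str = "('a set \<times> 'a set set) + (unit + unit)"

definition LHS_sp :: "'a tri \<Rightarrow> 'a lhs_str set" where
  "LHS_sp U = Inl ` GXXYZ U \<union> Inr ` (Inl ` XY_sp U \<union> Inr ` E2Z_sp U)"

fun transL :: "('a \<Rightarrow> 'a) \<Rightarrow> 'a lhs_str \<Rightarrow> 'a lhs_str" where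
  "transL \<sigma> (Inl (A, E)) = Inl (\<sigma> ` A, (`) \<sigma> ` E)"
| "transL \<sigma> (Inr x) = Inr x"

text \<open>(1 + X + E_{\<ge>2}(Z))[W] has exactly one structure iff W has one of the three shapes
  (the three summands live on disjoint shapes), otherwise none.\<close>
definition left_ok :: "'a tri \<Rightarrow> bool" where
  "left_ok W \<longleftrightarrow> (s1 W = {} \<and> s2 W = {} \<and> s3 W = {})
               \<or> (card (s1 W) = 1 \<and> s2 W = {} \<and> s3 W = {})
               \<or> (s1 W = {} \<and> s2 W = {} \<and> card (s3 W) \<ge> 2)"

text \<open>(E o T)-structures: partitions into tufts; T(X,Y) = X E_{\<ge>1}(Y) has one structure on
  (C1,C2,C3) iff |C1| = 1, C2 nonempty, C3 empty; E has one structure on every set.\<close>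
definition tuft_partition :: "'a tri set \<Rightarrow> 'a tri \<Rightarrow> bool" where
  "tuft_partition \<pi> V \<longleftrightarrow> tri_partition \<pi> V \<and>
     (\<forall>C\<in>\<pi>. card (s1 C) = 1 \<and> s2 C \<noteq> {} \<and> s3 C = {})"

text \<open>patches P = (1 + X + E_{\<ge>2}(Z)) (E o T) - 1; a product structure on B is a pair (W, \<pi>)
  with B = W + (B - W); the subtracted 1 is exactly the unique structure on the empty 3-set.\<close>
type_synonym 'a P_str = "'a tri \<times> 'a tri set"

definition P_sp :: "'a tri \<Rightarrow> 'a P_str set" where
  "P_sp B = {(W, \<pi>). tset B \<noteq> {} \<and> tri_sub W B \<and> left_ok W \<and> tuft_partition \<pi> (tri_diff B W)}"

fun transP :: "('a \<Rightarrow> 'a) \<Rightarrow> 'a P_str \<Rightarrow> 'a P_str" where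
  "transP \<sigma> (W, \<pi>) = (tri_img \<sigma> W, tri_img \<sigma> ` \<pi>)"

text \<open>composition M o P: a partition \<pi> of U, an M-structure on the set \<pi> of blocks, and
  (as a functional relation p) a P-structure on every block\<close>
type_synonym 'a MP_str = "'a tri set \<times> 'a tri set set \<times> ('a tri \<times> 'a P_str) set"

definition MP_sp :: "'a tri \<Rightarrow> 'a MP_str set" where
  "MP_sp U = {(\<pi>, g, p). tri_partition \<pi> U \<and> g \<in> M_sp \<pi> \<and>
                p \<subseteq> Sigma \<pi> P_sp \<and> (\<forall>B\<in>\<pi>. \<exists>!s. (B, s) \<in> p)}"

fun transMP :: "('a \<Rightarrow> 'a) \<Rightarrow> 'a MP_str \<Rightarrow> 'a MP_str" where
  "transMP \<sigma> (\<pi>, g, p) =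
     (tri_img \<sigma> ` \<pi>, (`) (tri_img \<sigma>) ` g, (\<lambda>(B, s). (tri_img \<sigma> B, transP \<sigma> s)) ` p)"

end

theory Submission
  imports Defs
begin

text \<open>
  Delete the leaves of sort Y from a connected graph and contract the classes of vertices that
  have become siblings. The quotient is again connected and has no siblings, and each class,
  together with the deleted leaves that hang on it, is a patch: its vertices that carried deleted
  leaves are the centres of the tufts, and the others are pairwise siblings in the original
  graph, so they form \<open>1\<close>, \<open>X\<close> or \<open>\<E>\<^bsub>\<ge>2\<^esub>(Z)\<close>. Conversely, a patch is blown up
  to a clique with pendant leaves. The two correction terms are the labellings of the
  single edge, whose vertices are at once leaves and siblings.
\<close>

text \<open>Away from the single edge, leaves and siblings do not interfere: the only neighbour of a
  leaf is neither a leaf nor a vertex with a sibling. Hence a leaf of sort Y always hangs on a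
  vertex of sort X. Whether a vertex of sort X is a leaf can be read off from the graph, so the
  substitution of X+Y for the leaf sort adds no data, and the left-hand side becomes a set of
  graphs.

  Deletion creates new siblings, because two vertices may be told apart only by their own Y-leaves.
  A vertex that carries a Y-leaf shares this leaf with no other vertex, so it cannot be a sibling of
  another remaining vertex in the original graph. The vertices of a class that carry no Y-leaf are
  genuine siblings of one another. If there is exactly one, it has no sibling and so has sort X; if
  there are two or more, all have sort Z. These cases, together with that of no such vertex, are the
  three summands of the first factor of a patch.

  No representative of a class is chosen anywhere, so naturality only requires that each ingredient
  commutes with injective relabelling.\<close>

lemma s_simps [simp]: "s1 (a, b, c) = a" "s2 (a, b, c) = b" "s3 (a, b, c) = c"
  by (simp_all add: s1_def s2_def s3_def)

lemma tri_eqI: "s1 U = s1 V \<Longrightarrow> s2 U = s2 V \<Longrightarrow> s3 U = s3 V \<Longrightarrow> U = V"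
  by (simp add: s1_def s2_def s3_def prod_eq_iff)

text \<open>The vertices that survive the deletion of the leaves of sort 2. For a block of a
  partition these are the vertices of the clique into which the block is blown up.\<close>

definition core :: "'a tri \<Rightarrow> 'a set" where
  "core U = s1 U \<union> s3 U"

text \<open>
  Unlike the conditions in \<open>Gne2\<close>, these also admit the single edge with labels of sorts 1 and 2
  and the single edge with two labels of sort 3, so the graphs below correspond to the whole
  left-hand side.
\<close>
definition patch_graph :: "'a tri \<Rightarrow> 'a set set \<Rightarrow> bool" where
  "patch_graph U E \<longleftrightarrow> connected_graph (tset U) E \<and>
     (\<forall>y\<in>s2 U. \<exists>c\<in>s1 U. nbhd E y = {c}) \<and>
     s3 U = {v\<in>core U. nbhd E v \<inter> s2 U = {} \<and>
               (\<exists>u\<in>core U. u \<noteq> v \<and> cnbhd E u = cnbhd E v)}"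

lemma patch_graph_leaf: "patch_graph U E \<Longrightarrow> y \<in> s2 U \<Longrightarrow> \<exists>c\<in>s1 U. nbhd E y = {c}"
  by (simp add: patch_graph_def)

lemma patch_graph_s3D:
  assumes "patch_graph U E" "v \<in> s3 U"
  shows "nbhd E v \<inter> s2 U = {}" "\<exists>u\<in>core U. u \<noteq> v \<and> cnbhd E u = cnbhd E v"
  using assms unfolding patch_graph_def by blast+

lemma patch_graph_s3I:
  "\<lbrakk>patch_graph U E; v \<in> core U; nbhd E v \<inter> s2 U = {}; u \<in> core U; u \<noteq> v; cnbhd E u = cnbhd E v\<rbrakk>
    \<Longrightarrow> v \<in> s3 U"
  unfolding patch_graph_def by blast

section \<open>Leaves and siblings in connected graphs\<close>

lemma mem_nbhd: "u \<in> nbhd E v \<longleftrightarrow> {u, v} \<in> E"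
  by (simp add: nbhd_def)

lemma nbhd_sym: "u \<in> nbhd E v \<longleftrightarrow> v \<in> nbhd E u"
  by (simp add: nbhd_def insert_commute)

lemma mem_cnbhd: "u \<in> cnbhd E v \<longleftrightarrow> u = v \<or> {u, v} \<in> E"
  by (simp add: cnbhd_def mem_nbhd)

lemma cnbhd_sym: "u \<in> cnbhd E v \<longleftrightarrow> v \<in> cnbhd E u"
  by (auto simp: mem_cnbhd insert_commute)

lemma graph_on_edgeD:
  assumes "graph_on W E" "{u, v} \<in> E"
  shows "u \<in> W" "v \<in> W" "u \<noteq> v"
  using assms by (auto simp: graph_on_def)

lemma graph_on_edgeE:
  assumes "graph_on W E" "e \<in> E"
  obtains u v where "e = {u, v}" "u \<noteq> v" "u \<in> W" "v \<in> W"
proof -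
  have "e \<subseteq> W" "card e = 2" using assms by (auto simp: graph_on_def)
  then show thesis using that by (auto simp: card_2_iff)
qed

lemma graph_on_nbhd: "graph_on W E \<Longrightarrow> nbhd E v \<subseteq> W - {v}"
  using graph_on_edgeD[of W E] unfolding mem_nbhd[symmetric] by blast

text \<open>No walk leaves a set that is closed under neighbours. This is how a connected graph is
  shown to be as small as a single edge.\<close>

lemma connected_graph_closed:
  assumes "connected_graph W E" "v \<in> S" "v \<in> W" "\<And>x. x \<in> S \<Longrightarrow> nbhd E x \<subseteq> S"
  shows "W \<subseteq> S"
proof
  fix w assume "w \<in> W"
  then have "(v, w) \<in> {(x, y). {x, y} \<in> E}\<^sup>*"
    using assms by (auto simp: connected_graph_def)
  then show "w \<in> S"
  proof induction
    case (step y z)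
    then have "z \<in> nbhd E y" by (auto simp: mem_nbhd insert_commute)
    with assms(4) step show ?case by blast
  qed (use assms in auto)
qed

lemma leafE:
  assumes "is_leaf E v" obtains c where "nbhd E v = {c}"
  using assms by (auto simp: is_leaf_def card_1_singleton_iff)

text \<open>The two leaves have no neighbours but each other, so together they are closed under
  neighbours.\<close>

lemma connected_graph_adjacent_leaves:
  assumes "connected_graph W E" "u \<in> W" "v \<in> nbhd E u" "is_leaf E u" "is_leaf E v"
  shows "card W = 2"
proof -
  have g: "graph_on W E" using assms by (simp add: connected_graph_def)
  have n: "nbhd E u = {v}" "nbhd E v = {u}"
    using assms nbhd_sym[of v E u] by (auto elim!: leafE)
  have "v \<in> W" "u \<noteq> v" using graph_on_nbhd[OF g, of u] n by auto
  moreover have "W \<subseteq> {u, v}"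
    by (rule connected_graph_closed[OF assms(1), of u]) (use n assms in auto)
  ultimately have "W = {u, v}" using assms by auto
  with \<open>u \<noteq> v\<close> show ?thesis by simp
qed

text \<open>A sibling is adjacent, so it is the unique neighbour of the leaf; equality of the closed
  neighbourhoods then makes it a leaf as well, and two adjacent leaves remain.\<close>

lemma connected_graph_leaf_sibling:
  assumes "connected_graph W E" "u \<in> W" "is_leaf E u" "v \<noteq> u" "cnbhd E u = cnbhd E v"
  shows "card W = 2"
proof -
  have g: "graph_on W E" using assms by (simp add: connected_graph_def)
  obtain c where c: "nbhd E u = {c}" using assms by (elim leafE)
  have "v \<in> cnbhd E u" using assms by (auto simp: cnbhd_def)
  then have "v = c" using assms c by (auto simp: cnbhd_def)
  have "insert v (nbhd E v) = {u, v}" using assms c \<open>v = c\<close> by (auto simp: cnbhd_def)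
  then have "nbhd E v = {u}" using graph_on_nbhd[OF g, of v] assms by auto
  then show ?thesis using connected_graph_adjacent_leaves[OF assms(1,2), of v] assms(3) c \<open>v = c\<close>
    by (simp add: is_leaf_def)
qed

lemma connected_graph_card_2:
  assumes "connected_graph {u, v} E" "u \<noteq> v"
  shows "E = {{u, v}}"
proof -
  have g: "graph_on {u, v} E" using assms by (simp add: connected_graph_def)
  have sub: "E \<subseteq> {{u, v}}" using g assms by (auto elim!: graph_on_edgeE[OF g])
  moreover have "E \<noteq> {}"
  proof
    assume "E = {}"
    have "{u, v} \<subseteq> {u}"
      by (rule connected_graph_closed[OF assms(1), of u]) (auto simp: \<open>E = {}\<close> nbhd_def)
    with assms show False by auto
  qed
  ultimately show ?thesis by auto
qed

lemma K2_nbhd: "u \<noteq> v \<Longrightarrow> nbhd {{u, v}} u = {v}" "u \<noteq> v \<Longrightarrow> nbhd {{u, v}} v = {u}"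
  by (auto simp: nbhd_def doubleton_eq_iff)

lemma K2_connected: "u \<noteq> v \<Longrightarrow> connected_graph {u, v} {{u, v}}"
  by (auto simp: connected_graph_def graph_on_def insert_commute)

section \<open>The left-hand side as a set of graphs\<close>

lemma GXXYZ_D:
  assumes "(A, E) \<in> GXXYZ U"
  shows "connected_graph (tset U) E" "A \<union> s2 U = {v\<in>tset U. is_leaf E v}"
    "s3 U = {v\<in>tset U. has_sibling (tset U) E v}" "A \<subseteq> s1 U"
proof -
  have A: "A \<subseteq> s1 U" and E: "E \<in> Gne2 (s1 U - A, A \<union> s2 U, s3 U)"
    using assms by (auto simp: GXXYZ_def)
  have t: "tset (s1 U - A, A \<union> s2 U, s3 U) = tset U"
    using A by (auto simp: tset_def)
  show "connected_graph (tset U) E" "A \<union> s2 U = {v\<in>tset U. is_leaf E v}"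
    "s3 U = {v\<in>tset U. has_sibling (tset U) E v}" "A \<subseteq> s1 U"
    using A E unfolding Gne2_def t by auto
qed

lemma GXXYZ_I:
  assumes "connected_graph (tset U) E" "A \<union> s2 U = {v\<in>tset U. is_leaf E v}"
    "s3 U = {v\<in>tset U. has_sibling (tset U) E v}" "A \<subseteq> s1 U"
  shows "(A, E) \<in> GXXYZ U"
proof -
  have t: "tset (s1 U - A, A \<union> s2 U, s3 U) = tset U"
    using assms(4) by (auto simp: tset_def)
  show ?thesis unfolding GXXYZ_def Gne2_def mem_Collect_eq prod.case t s_simps using assms by blast
qed

text \<open>Both ends of a single edge are leaves and siblings at once, while leaves and vertices
  with siblings must carry disjoint sorts. This gap is what the two correction terms fill.\<close>

lemma GXXYZ_card:
  assumes ok: "tri_ok U" and AE: "(A, E) \<in> GXXYZ U"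
  shows "card (tset U) \<noteq> 2"
proof
  assume "card (tset U) = 2"
  then obtain u v where uv: "tset U = {u, v}" "u \<noteq> v" by (auto simp: card_2_iff)
  note D = GXXYZ_D[OF AE]
  have E: "E = {{u, v}}" using connected_graph_card_2 D(1) uv by metis
  have "cnbhd E u = cnbhd E v" using K2_nbhd[OF uv(2)] by (auto simp: cnbhd_def E)
  then have "u \<in> s3 U" using D(3) uv by (auto simp: has_sibling_def)
  moreover have "u \<in> A \<union> s2 U" unfolding D(2) using K2_nbhd[OF uv(2)] uv by (simp add: is_leaf_def E)
  ultimately show False using D(4) ok by (auto simp: tri_ok_def)
qed

text \<open>The work lies in placing the neighbour of a Y-leaf in sort 1: with more than two
  vertices it is neither a leaf nor a vertex with a sibling. Therefore vertices of sort 3 have no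
  neighbours in \<open>s2 U\<close>, and their siblings, again of sort 3, lie in the core.\<close>

lemma patch_graph_if_GXXYZ:
  assumes ok: "tri_ok U" and AE: "(A, E) \<in> GXXYZ U"
  shows "patch_graph U E"
proof -
  note D = GXXYZ_D[OF AE]
  note c2 = GXXYZ_card[OF ok AE]
  have g: "graph_on (tset U) E" using D(1) by (simp add: connected_graph_def)
  have leaf: "\<exists>c\<in>s1 U. nbhd E y = {c}" if y: "y \<in> s2 U" for y
  proof -
    have ly: "is_leaf E y" "y \<in> tset U" using D(2) y by auto
    then obtain c where c: "nbhd E y = {c}" by (elim leafE)
    have cU: "c \<in> tset U" using graph_on_nbhd[OF g, of y] c by auto
    have "\<not> is_leaf E c" using connected_graph_adjacent_leaves[OF D(1) ly(2) _ ly(1), of c] c c2 by auto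
    then have "c \<notin> s2 U" using D(2) by auto
    moreover have "c \<notin> s3 U"
    proof
      assume "c \<in> s3 U"
      then obtain u where u: "u \<in> tset U" "u \<noteq> c" "cnbhd E u = cnbhd E c"
        using D(3) by (auto simp: has_sibling_def)
      have "y \<in> cnbhd E c" using c nbhd_sym[of c E y] by (auto simp: cnbhd_def)
      then have "y \<in> cnbhd E u" using u by simp
      \<comment> \<open>Either the leaf \<open>y\<close> is itself the sibling of \<open>c\<close>,
        which only happens in a single edge, or \<open>u\<close> is a second neighbour of
        \<open>y\<close>.\<close>
      then consider "y = u" | "u \<in> nbhd E y" using nbhd_sym[of y E u] by (auto simp: cnbhd_def)
      then show False
        using connected_graph_leaf_sibling[OF D(1) ly(2,1), of c] u c c2 by cases auto
    qed
    ultimately show ?thesis using c cU by (auto simp: tset_def)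
  qed
  have "s3 U = {v\<in>core U. nbhd E v \<inter> s2 U = {} \<and> (\<exists>u\<in>core U. u \<noteq> v \<and> cnbhd E u = cnbhd E v)}"
    (is "_ = ?R")
  proof
    show "s3 U \<subseteq> ?R"
    proof
      fix v assume v: "v \<in> s3 U"
      then obtain u where u: "u \<in> tset U" "u \<noteq> v" "cnbhd E u = cnbhd E v"
        using D(3) by (auto simp: has_sibling_def)
      moreover have "v \<in> tset U" using v by (simp add: tset_def)
      ultimately have "u \<in> s3 U" using D(3) by (auto simp: has_sibling_def)
      moreover have "nbhd E v \<inter> s2 U = {}"
      proof (rule ccontr)
        assume "nbhd E v \<inter> s2 U \<noteq> {}"
        then obtain y where y: "y \<in> s2 U" "v \<in> nbhd E y" using nbhd_sym[of _ E v] by auto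
        then have "v \<in> s1 U" using leaf by force
        then show False using v ok by (auto simp: tri_ok_def)
      qed
      ultimately show "v \<in> ?R" using u v by (auto simp: core_def)
    qed
    have "core U \<subseteq> tset U" by (auto simp: core_def tset_def)
    then show "?R \<subseteq> s3 U" unfolding D(3) has_sibling_def by blast
  qed
  then show ?thesis using D(1) leaf by (auto simp: patch_graph_def)
qed

text \<open>The first component is forced: the labels of sort 1 that are substituted for leaves are
  exactly those at which the graph has a leaf.\<close>

lemma GXXYZ_if_patch_graph:
  assumes ok: "tri_ok U" and PG: "patch_graph U E" and c2: "card (tset U) \<noteq> 2"
  shows "({v\<in>s1 U. is_leaf E v}, E) \<in> GXXYZ U"
proof (rule GXXYZ_I)
  show con: "connected_graph (tset U) E" using PG by (simp add: patch_graph_def)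
  note leaf = patch_graph_leaf[OF PG] and s3D = patch_graph_s3D[OF PG] and s3I = patch_graph_s3I[OF PG]
  have nosib: "\<not> is_leaf E u" if "u \<in> tset U" "v \<noteq> u" "cnbhd E u = cnbhd E v" for u v
    using connected_graph_leaf_sibling[OF con] that c2 by blast
  have s2leaf: "is_leaf E y" if "y \<in> s2 U" for y
    using leaf[OF that] by (auto simp: is_leaf_def)
  have "\<not> is_leaf E v" if v: "v \<in> s3 U" for v
  proof -
    obtain u where "u \<noteq> v" "cnbhd E u = cnbhd E v" using s3D(2)[OF v] by auto
    then show ?thesis using nosib[of v u] that by (auto simp: tset_def)
  qed
  then show "{v\<in>s1 U. is_leaf E v} \<union> s2 U = {v\<in>tset U. is_leaf E v}"
    using s2leaf by (auto simp: tset_def)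
  show "s3 U = {v\<in>tset U. has_sibling (tset U) E v}"
  proof
    show "s3 U \<subseteq> {v\<in>tset U. has_sibling (tset U) E v}"
      using s3D(2) by (fastforce simp: has_sibling_def core_def tset_def)
    show "{v\<in>tset U. has_sibling (tset U) E v} \<subseteq> s3 U"
    proof
      fix v assume "v \<in> {v\<in>tset U. has_sibling (tset U) E v}"
      then obtain u where u: "u \<in> tset U" "v \<in> tset U" "u \<noteq> v" "cnbhd E u = cnbhd E v"
        by (auto simp: has_sibling_def)
      have "u \<in> core U" "v \<in> core U"
        using nosib[of u v] nosib[of v u] u s2leaf by (auto simp: core_def tset_def)
      moreover have "nbhd E v \<inter> s2 U = {}"
      proof (rule ccontr)
        assume "nbhd E v \<inter> s2 U \<noteq> {}"
        then obtain y where y: "y \<in> s2 U" "y \<in> nbhd E v" by auto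
        then have "y \<in> cnbhd E u" using u by (auto simp: cnbhd_def)
        moreover have "y \<noteq> u" using y s2leaf nosib[of u v] u by auto
        ultimately have "u \<in> nbhd E y" "v \<in> nbhd E y"
          using y nbhd_sym[of y E u] nbhd_sym[of y E v] by (auto simp: cnbhd_def)
        then show False using leaf[OF y(1)] u by auto
      qed
      ultimately show "v \<in> s3 U" using u by (intro s3I)
    qed
  qed
qed auto

text \<open>Two labels of sort 1 are impossible, since they would be siblings without neighbours in
  \<open>s2 U\<close> and so belong to sort 3. One label of sort 3 needs a sibling in the core,
  which forces the other label to have sort 3 too.\<close>

lemma patch_graph_card_2:
  assumes ok: "tri_ok U" and PG: "patch_graph U E" and "card (tset U) = 2"
  shows "E = {tset U}" "s3 U = {} \<Longrightarrow> XY_sp U = {()}" "s3 U \<noteq> {} \<Longrightarrow> E2Z_sp U = {()}"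
proof -
  obtain u v where uv: "tset U = {u, v}" "u \<noteq> v" using assms by (auto simp: card_2_iff)
  note leaf = patch_graph_leaf[OF PG] and s3D = patch_graph_s3D[OF PG] and s3I = patch_graph_s3I[OF PG]
  have E: "E = {{u, v}}" using connected_graph_card_2 PG uv by (metis patch_graph_def)
  then show "E = {tset U}" using uv by simp
  note n = K2_nbhd[OF uv(2), folded E]
  have core_cnbhd: "cnbhd E u = cnbhd E v" using n by (auto simp: cnbhd_def)
  have dis: "s1 U \<inter> s2 U = {}" "s1 U \<inter> s3 U = {}" "s2 U \<inter> s3 U = {}" "s1 U \<union> s2 U \<union> s3 U = {u, v}"
    using ok uv by (auto simp: tri_ok_def tset_def)
  show "XY_sp U = {()}" if z: "s3 U = {}"
  proof -
    have "(s1 U = {u} \<and> s2 U = {v}) \<or> (s1 U = {v} \<and> s2 U = {u})"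
    proof (cases "u \<in> s2 U")
      case True
      then have "v \<in> s1 U" using leaf[of u] n by auto
      with True dis z show ?thesis by auto
    next
      case False
      then have u: "u \<in> s1 U" using dis z by auto
      have "v \<in> s2 U"
      proof (rule ccontr)
        assume "v \<notin> s2 U"
        then have "v \<in> s1 U" "s2 U = {}" using dis z False by auto
        then have "v \<in> s3 U" using core_cnbhd u uv by (intro s3I[of v u]) (auto simp: core_def)
        with z show False by simp
      qed
      with u dis z show ?thesis by auto
    qed
    then show ?thesis using z by (auto simp: XY_sp_def)
  qed
  show "E2Z_sp U = {()}" if z: "s3 U \<noteq> {}"
  proof -
    obtain w where w: "w \<in> s3 U" using z by auto
    then have w': "nbhd E w \<inter> s2 U = {}" "\<exists>u\<in>core U. u \<noteq> w" "w \<in> core U"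
      using s3D[OF w] w by (auto simp: core_def)
    have sub: "core U \<subseteq> {u, v}" "core U \<inter> s2 U = {}" "s2 U \<subseteq> {u, v}"
      unfolding core_def using dis by blast+
    then have "core U = {u, v}" using w' by blast
    moreover from this have "s2 U = {}" using sub by blast
    ultimately have "core U = {u, v}" "s2 U = {}" by auto
    then have "s3 U = {u, v}" using uv core_cnbhd s3I[of u v] s3I[of v u] dis by auto
    then show ?thesis using dis uv by (auto simp: E2Z_sp_def)
  qed
qed

lemma patch_graph_K2:
  assumes ok: "tri_ok U" and "XY_sp U \<noteq> {} \<or> E2Z_sp U \<noteq> {}"
  shows "patch_graph U {tset U}" "card (tset U) = 2" "XY_sp U \<noteq> {} \<Longrightarrow> s3 U = {}" "E2Z_sp U \<noteq> {} \<Longrightarrow> s3 U \<noteq> {}"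
proof -
  have "patch_graph U {tset U} \<and> card (tset U) = 2"
  proof (cases "XY_sp U \<noteq> {}")
    case True
    then obtain x y where s: "s1 U = {x}" "s2 U = {y}" "s3 U = {}"
      by (auto simp: XY_sp_def card_1_singleton_iff split: if_splits)
    then have "x \<noteq> y" "tset U = {x, y}" using ok by (auto simp: tri_ok_def tset_def)
    then show ?thesis using K2_nbhd[of x y] K2_connected[of x y]
      by (simp add: patch_graph_def s core_def)
  next
    case False
    with assms have "s1 U = {}" "s2 U = {}" "card (s3 U) = 2"
      by (auto simp: E2Z_sp_def split: if_splits)
    then obtain x y where s: "s1 U = {}" "s2 U = {}" "s3 U = {x, y}" "x \<noteq> y" by (auto simp: card_2_iff)
    then have "tset U = {x, y}" by (auto simp: tset_def)
    then show ?thesis using K2_nbhd[of x y] K2_connected[of x y] s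
      by (auto simp: patch_graph_def core_def cnbhd_def)
  qed
  then show "patch_graph U {tset U}" "card (tset U) = 2" by auto
  show "XY_sp U \<noteq> {} \<Longrightarrow> s3 U = {}" by (auto simp: XY_sp_def split: if_splits)
  show "E2Z_sp U \<noteq> {} \<Longrightarrow> s3 U \<noteq> {}" by (auto simp: E2Z_sp_def split: if_splits)
qed

fun lhs_graph :: "'a tri \<Rightarrow> 'a lhs_str \<Rightarrow> 'a set set" where
  "lhs_graph U (Inl (A, E)) = E"
| "lhs_graph U (Inr x) = {tset U}"

text \<open>The substitution has no structures on two labels, so the number of labels tells whether
  the graph comes from a correction term, and the presence of sort 3 tells from which one.\<close>

definition graph_lhs :: "'a tri \<Rightarrow> 'a set set \<Rightarrow> 'a lhs_str" where
  "graph_lhs U E =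
     (if card (tset U) = 2 then Inr (if s3 U = {} then Inl () else Inr ())
      else Inl ({v\<in>s1 U. is_leaf E v}, E))"

lemma bij_betw_lhs_graph:
  assumes ok: "tri_ok U"
  shows "bij_betw (lhs_graph U) (LHS_sp U) (Collect (patch_graph U))"
proof (rule bij_betw_byWitness[where f' = "graph_lhs U"])
  have LHS: thesis if "s \<in> LHS_sp U" "\<And>A E. s = Inl (A, E) \<Longrightarrow> (A, E) \<in> GXXYZ U \<Longrightarrow> thesis"
    "s = Inr (Inl ()) \<Longrightarrow> XY_sp U \<noteq> {} \<Longrightarrow> thesis" "s = Inr (Inr ()) \<Longrightarrow> E2Z_sp U \<noteq> {} \<Longrightarrow> thesis"
    for s thesis
    using that by (auto simp: LHS_sp_def) blast+
  show "\<forall>s\<in>LHS_sp U. graph_lhs U (lhs_graph U s) = s"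
  proof
    fix s assume "s \<in> LHS_sp U"
    from LHS[OF this] show "graph_lhs U (lhs_graph U s) = s"
    proof cases
      case (1 A E)
      have "A = {v\<in>s1 U. is_leaf E v}"
        using GXXYZ_D(2,4)[OF 1(2)] ok by (auto simp: tri_ok_def tset_def)
      then show ?thesis using 1 GXXYZ_card[OF ok 1(2)] by (auto simp: graph_lhs_def)
    qed (use patch_graph_K2[OF ok] in \<open>auto simp: graph_lhs_def\<close>)
  qed
  show "\<forall>E\<in>Collect (patch_graph U). lhs_graph U (graph_lhs U E) = E"
    using patch_graph_card_2[OF ok] by (auto simp: graph_lhs_def)
  have "lhs_graph U s \<in> Collect (patch_graph U)" if "s \<in> LHS_sp U" for s
    using LHS[OF that] by cases (use patch_graph_K2(1)[OF ok] patch_graph_if_GXXYZ[OF ok] in auto)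
  then show "lhs_graph U ` LHS_sp U \<subseteq> Collect (patch_graph U)" by blast
  have "graph_lhs U E \<in> LHS_sp U" if E: "patch_graph U E" for E
  proof (cases "card (tset U) = 2")
    case True
    then show ?thesis using patch_graph_card_2(2,3)[OF ok E] by (simp add: graph_lhs_def LHS_sp_def)
  next
    case False
    then show ?thesis using GXXYZ_if_patch_graph[OF ok E] by (simp add: graph_lhs_def LHS_sp_def)
  qed
  then show "graph_lhs U ` Collect (patch_graph U) \<subseteq> LHS_sp U" by blast
qed

lemma tset_tri_img: "tset (tri_img \<sigma> U) = \<sigma> ` tset U"
  by (simp add: tset_def tri_img_def image_Un)

lemma lhs_graph_transL: "lhs_graph (tri_img \<sigma> U) (transL \<sigma> s) = (`) \<sigma> ` lhs_graph U s"
  by (cases "(\<sigma>, s)" rule: transL.cases) (simp_all add: tset_tri_img)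

section \<open>The patches of a graph and the graph glued from patches\<close>

definition core_cnbhd :: "'a tri \<Rightarrow> 'a set set \<Rightarrow> 'a \<Rightarrow> 'a set" where
  "core_cnbhd U E v = cnbhd E v \<inter> core U"

text \<open>Siblings after deletion of the vertices of sort 2.\<close>
definition twin_class :: "'a tri \<Rightarrow> 'a set set \<Rightarrow> 'a \<Rightarrow> 'a set" where
  "twin_class U E v = {u\<in>core U. core_cnbhd U E u = core_cnbhd U E v}"

definition tufted :: "'a tri \<Rightarrow> 'a set set \<Rightarrow> 'a set" where
  "tufted U E = {v\<in>core U. nbhd E v \<inter> s2 U \<noteq> {}}"

text \<open>The leaves of sort 2 join the class of the vertex on which they hang.\<close>

definition twin_block :: "'a tri \<Rightarrow> 'a set set \<Rightarrow> 'a \<Rightarrow> 'a tri" where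
  "twin_block U E v = (s1 U \<inter> twin_class U E v, {y\<in>s2 U. \<exists>c\<in>twin_class U E v. c \<in> nbhd E y}, s3 U \<inter> twin_class U E v)"

text \<open>Tufted vertices are removed in sort 1 only, because in a \<open>patch_graph\<close> they
  all have sort 1.\<close>

definition untufted_part :: "'a tri \<Rightarrow> 'a set set \<Rightarrow> 'a \<Rightarrow> 'a tri" where
  "untufted_part U E v = (s1 U \<inter> twin_class U E v - tufted U E, {}, s3 U \<inter> twin_class U E v)"

definition tuft :: "'a tri \<Rightarrow> 'a set set \<Rightarrow> 'a \<Rightarrow> 'a tri" where
  "tuft U E x = ({x}, nbhd E x \<inter> s2 U, {})"

definition tufts :: "'a tri \<Rightarrow> 'a set set \<Rightarrow> 'a \<Rightarrow> 'a tri set" where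
  "tufts U E v = tuft U E ` (twin_class U E v \<inter> tufted U E)"

text \<open>Blocks are indexed by all their core vertices instead of by representatives; the values
  depend on the class only. Edges inside a class would become loops of the quotient, hence the
  inequality in the second component.\<close>

definition decomp :: "'a tri \<Rightarrow> 'a set set \<Rightarrow> 'a MP_str" where
  "decomp U E = (twin_block U E ` core U,
     (\<lambda>(u, v). {twin_block U E u, twin_block U E v}) `
       {(u, v). u \<in> core U \<and> v \<in> core U \<and> {u, v} \<in> E \<and> core_cnbhd U E u \<noteq> core_cnbhd U E v},
     (\<lambda>v. (twin_block U E v, (untufted_part U E v, tufts U E v))) ` core U)"

text \<open>The three alternatives are the edges of the clique on the core of a block, those of the
  complete join between the cores of adjacent blocks, and the pendant edges of the tufts.\<close>

fun glue :: "'a MP_str \<Rightarrow> 'a set set" where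
  "glue (\<pi>, g, p) = {{u, v} | u v. u \<noteq> v \<and>
     ((\<exists>B\<in>\<pi>. u \<in> core B \<and> v \<in> core B) \<or>
      (\<exists>B B'. {B, B'} \<in> g \<and> u \<in> core B \<and> v \<in> core B') \<or>
      (\<exists>B W \<tau> C. (B, (W, \<tau>)) \<in> p \<and> C \<in> \<tau> \<and> u \<in> s1 C \<and> v \<in> s2 C))}"

declare glue.simps [simp del]

lemma glue_blockI: "B \<in> \<pi> \<Longrightarrow> u \<in> core B \<Longrightarrow> v \<in> core B \<Longrightarrow> u \<noteq> v \<Longrightarrow> {u, v} \<in> glue (\<pi>, g, p)"
  unfolding glue.simps by blast

lemma glue_edgeI:
  "{B, B'} \<in> g \<Longrightarrow> u \<in> core B \<Longrightarrow> v \<in> core B' \<Longrightarrow> u \<noteq> v \<Longrightarrow> {u, v} \<in> glue (\<pi>, g, p)"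
  unfolding glue.simps by blast

lemma glue_tuftI:
  "(B, (W, \<tau>)) \<in> p \<Longrightarrow> C \<in> \<tau> \<Longrightarrow> u \<in> s1 C \<Longrightarrow> v \<in> s2 C \<Longrightarrow> u \<noteq> v \<Longrightarrow> {u, v} \<in> glue (\<pi>, g, p)"
  unfolding glue.simps by blast

lemma glueE:
  assumes "e \<in> glue (\<pi>, g, p)"
  obtains (block) u v B where "e = {u, v}" "u \<noteq> v" "B \<in> \<pi>" "u \<in> core B" "v \<in> core B"
    | (edge) u v B B' where "e = {u, v}" "u \<noteq> v" "{B, B'} \<in> g" "u \<in> core B" "v \<in> core B'"
    | (tuft) u v B W \<tau> C where "e = {u, v}" "u \<noteq> v" "(B, (W, \<tau>)) \<in> p" "C \<in> \<tau>" "u \<in> s1 C" "v \<in> s2 C"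
  using assms unfolding glue.simps by blast

lemma tset_core: "tset U = core U \<union> s2 U"
  by (auto simp: tset_def core_def)

lemma tri_ok_disjoint:
  assumes "tri_ok U"
  shows "core U \<inter> s2 U = {}" "s1 U \<inter> s3 U = {}" "finite (core U)" "finite (s2 U)"
  using assms by (auto simp: tri_ok_def core_def tset_def)

section \<open>From a graph to a co-mating graph of patches\<close>

locale patched =
  fixes U :: "'a tri" and E :: "'a set set"
  assumes ok: "tri_ok U" and PG: "patch_graph U E"
begin

abbreviation "N \<equiv> core_cnbhd U E"
abbreviation "bl \<equiv> twin_block U E"

lemma con: "connected_graph (tset U) E"
  using PG by (simp add: patch_graph_def)

lemma gr: "graph_on (tset U) E"
  using con by (simp add: connected_graph_def)

lemmas disj = tri_ok_disjoint[OF ok]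

lemma nbr_s2:
  assumes "y \<in> s2 U" "c \<in> nbhd E y"
  shows "nbhd E y = {c}" "c \<in> s1 U" "c \<in> core U" "c \<in> tufted U E"
proof -
  show "nbhd E y = {c}" "c \<in> s1 U" using patch_graph_leaf[OF PG assms(1)] assms(2) by auto
  then show "c \<in> core U" by (simp add: core_def)
  then show "c \<in> tufted U E" using assms nbhd_sym[of y E c] by (auto simp: tufted_def)
qed

lemma tufted_s1: "tufted U E \<subseteq> s1 U"
  using nbr_s2(2) nbhd_sym[of _ E] by (fastforce simp: tufted_def)

lemma N_refl: "v \<in> core U \<Longrightarrow> v \<in> N v"
  by (simp add: core_cnbhd_def cnbhd_def)

lemma N_core: "u \<in> N v \<Longrightarrow> u \<in> core U"
  by (simp add: core_cnbhd_def)

lemma N_sym: "u \<in> core U \<Longrightarrow> v \<in> core U \<Longrightarrow> u \<in> N v \<longleftrightarrow> v \<in> N u"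
  using cnbhd_sym[of u E v] by (auto simp: core_cnbhd_def)

lemma N_iff: "u \<in> core U \<Longrightarrow> u \<in> N v \<longleftrightarrow> u = v \<or> {u, v} \<in> E"
  by (simp add: core_cnbhd_def mem_cnbhd)

lemma twin_class_iff: "u \<in> twin_class U E v \<longleftrightarrow> u \<in> core U \<and> N u = N v"
  by (simp add: twin_class_def)

lemma core_twin_block: "core (bl v) = twin_class U E v"
  by (auto simp: core_def twin_block_def twin_class_def)

lemma twin_block_cong: "N u = N v \<Longrightarrow> bl u = bl v \<and> untufted_part U E u = untufted_part U E v \<and> tufts U E u = tufts U E v"
  by (simp add: twin_block_def untufted_part_def tufts_def twin_class_def)

lemma twin_block_eq_iff:
  assumes "u \<in> core U"
  shows "bl u = bl v \<longleftrightarrow> N u = N v"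
proof
  assume "bl u = bl v"
  then have "twin_class U E u = twin_class U E v" using core_twin_block by metis
  moreover have "u \<in> twin_class U E u" using assms by (simp add: twin_class_iff)
  ultimately show "N u = N v" by (simp add: twin_class_iff)
qed (use twin_block_cong in blast)

text \<open>Disjointness in sort 2, and the fact that sort 2 is covered, both come from each leaf
  having exactly one neighbour, which lies in the core.\<close>

lemma twin_block_partition: "tri_partition (bl ` core U) U"
  unfolding tri_partition_def
proof (intro conjI ballI impI)
  show "finite (bl ` core U)" using disj by simp
  fix B assume "B \<in> bl ` core U"
  then obtain v where v: "v \<in> core U" "B = bl v" by auto
  show "tri_sub B U" by (auto simp: v tri_sub_def twin_block_def)
  show "tset B \<noteq> {}" using v by (auto simp: tset_core core_twin_block twin_class_iff)
  fix B' assume "B' \<in> bl ` core U" "B \<noteq> B'"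
  then obtain v' where v': "v' \<in> core U" "B' = bl v'" by auto
  with \<open>B \<noteq> B'\<close> v have ne: "N v \<noteq> N v'" using twin_block_eq_iff by simp
  have sub: "s2 (bl v) \<subseteq> s2 U" "twin_class U E v \<subseteq> core U" for v by (auto simp: twin_block_def twin_class_def)
  have "twin_class U E v \<inter> twin_class U E v' = {}" using ne by (auto simp: twin_class_iff)
  moreover have "s2 (bl v) \<inter> s2 (bl v') = {}"
  proof (rule ccontr)
    assume "\<not> ?thesis"
    then obtain y c c' where y: "y \<in> s2 U" "c \<in> twin_class U E v" "c' \<in> twin_class U E v'" "c \<in> nbhd E y" "c' \<in> nbhd E y"
      by (auto simp: twin_block_def)
    then have "c = c'" using nbr_s2(1) by blast
    then show False using y ne by (auto simp: twin_class_iff)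
  qed
  ultimately show "tset B \<inter> tset B' = {}"
    using sub[of v] sub[of v'] disj(1) unfolding v v' tset_core core_twin_block by blast
next
  show "\<Union> (s1 ` bl ` core U) = s1 U" "\<Union> (s3 ` bl ` core U) = s3 U"
    by (auto simp: twin_block_def twin_class_def core_def)
  show "\<Union> (s2 ` bl ` core U) = s2 U"
  proof
    show "s2 U \<subseteq> \<Union> (s2 ` bl ` core U)"
    proof
      fix y assume y: "y \<in> s2 U"
      then obtain c where c: "c \<in> nbhd E y" using patch_graph_leaf[OF PG] by blast
      then have "c \<in> core U" using nbr_s2 y by auto
      moreover then have "y \<in> s2 (bl c)" using c y by (auto simp: twin_block_def twin_class_iff)
      ultimately show "y \<in> \<Union> (s2 ` bl ` core U)" by blast
    qed
  qed (auto simp: twin_block_def)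
qed

definition "g = (\<lambda>(u, v). {bl u, bl v}) `
       {(u, v). u \<in> core U \<and> v \<in> core U \<and> {u, v} \<in> E \<and> N u \<noteq> N v}"

lemma decomp_g: "decomp U E = (bl ` core U, g, (\<lambda>v. (bl v, (untufted_part U E v, tufts U E v))) ` core U)"
  by (simp add: decomp_def g_def)

text \<open>Adjacency of classes does not depend on the vertices that witness it: if
  \<open>{a, b}\<close> is an edge with \<open>N u = N a\<close> and \<open>N v = N b\<close>, then
  \<open>b\<close> lies in \<open>N a = N u\<close>, so \<open>u\<close> lies in
  \<open>N b = N v\<close> by symmetry.\<close>

lemma g_edge:
  assumes "u \<in> core U" "v \<in> core U"
  shows "bl u \<in> cnbhd g (bl v) \<longleftrightarrow> u \<in> N v"
proof
  assume "u \<in> N v"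
  then have "u = v \<or> {u, v} \<in> E" using N_iff assms by auto
  then show "bl u \<in> cnbhd g (bl v)"
  proof
    assume uv: "{u, v} \<in> E"
    show ?thesis
    proof (cases "N u = N v")
      case True
      then show ?thesis using twin_block_cong[OF True] by (simp add: mem_cnbhd)
    next
      case False
      then have "{bl u, bl v} \<in> g" using uv assms by (auto simp: g_def)
      then show ?thesis by (simp add: mem_cnbhd)
    qed
  qed (simp add: mem_cnbhd)
next
  assume "bl u \<in> cnbhd g (bl v)"
  then consider "bl u = bl v" | "{bl u, bl v} \<in> g" unfolding mem_cnbhd by blast
  then show "u \<in> N v"
  proof cases
    case 1
    then have "N u = N v" using twin_block_eq_iff assms by simp
    then show ?thesis using N_refl assms by blast
  next
    case 2
    then obtain a b where ab: "a \<in> core U" "b \<in> core U" "{a, b} \<in> E" "{bl u, bl v} = {bl a, bl b}"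
      unfolding g_def by auto
    have "\<exists>a b. a \<in> core U \<and> b \<in> core U \<and> {a, b} \<in> E \<and> N u = N a \<and> N v = N b"
    proof (cases "bl u = bl a \<and> bl v = bl b")
      case True
      then show ?thesis using ab assms twin_block_eq_iff by blast
    next
      case False
      then have "bl u = bl b \<and> bl v = bl a" using ab by (auto simp: doubleton_eq_iff)
      then show ?thesis using ab assms twin_block_eq_iff by (metis insert_commute)
    qed
    then obtain a b where ab: "a \<in> core U" "b \<in> core U" "{a, b} \<in> E" "N u = N a" "N v = N b" by blast
    have "b \<in> N u" using ab N_iff[of b a] by (simp add: insert_commute)
    then have "u \<in> N v" using N_sym assms ab by auto
    then show ?thesis .
  qed
qed

lemma g_graph: "graph_on (bl ` core U) g"
  using disj(3) twin_block_eq_iff by (auto simp: graph_on_def g_def)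

lemma g_connected: "connected_graph (bl ` core U) g"
  unfolding connected_graph_def
proof (intro conjI ballI)
  show "graph_on (bl ` core U) g" by (rule g_graph)
  show "bl ` core U \<noteq> {}"
    \<comment> \<open>If some label has sort 2, its neighbour lies in the core, so the core is never
      empty.\<close>
    using con patch_graph_leaf[OF PG] by (auto simp: connected_graph_def tset_core core_def)
  fix B B' assume "B \<in> bl ` core U" "B' \<in> bl ` core U"
  then obtain u w where uw: "B = bl u" "B' = bl w" "u \<in> core U" "w \<in> core U" by auto
  \<comment> \<open>retracts the graph onto its core, so that walks can be pushed to the quotient\<close>
  define rep where "rep v = (if v \<in> s2 U then THE c. nbhd E v = {c} else v)" for v
  have rep: "rep y = c" if "y \<in> s2 U" "c \<in> nbhd E y" for y c
    using nbr_s2[OF that] that by (auto simp: rep_def)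
  have rep': "rep v = v" if "v \<in> core U" for v
    using that disj by (auto simp: rep_def)
  have "(u, w) \<in> {(x, y). {x, y} \<in> E}\<^sup>*"
    using con uw by (auto simp: connected_graph_def tset_core)
  then have "(bl u, bl (rep w)) \<in> {(x, y). {x, y} \<in> g}\<^sup>*"
  proof induction
    case base
    then show ?case using rep'[OF uw(3)] by simp
  next
    case (step x y)
    then have E: "{x, y} \<in> E" by simp
    have xy: "x \<in> tset U" "y \<in> tset U" "x \<in> nbhd E y" "y \<in> nbhd E x"
      using graph_on_edgeD[OF gr E] E by (auto simp: mem_nbhd insert_commute)
    show ?case
    proof (cases "x \<in> s2 U \<or> y \<in> s2 U")
      case True
      have "rep x = rep y"
      proof (cases "x \<in> s2 U")
        case True
        then show ?thesis using rep[OF True xy(4)] rep'[OF nbr_s2(3)[OF True xy(4)]] by simp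
      next
        case False
        then have y: "y \<in> s2 U" using \<open>x \<in> s2 U \<or> y \<in> s2 U\<close> by simp
        then show ?thesis using rep[OF y xy(3)] rep'[OF nbr_s2(3)[OF y xy(3)]] by simp
      qed
      then show ?thesis using step.IH by simp
    next
      case False
      then have c: "x \<in> core U" "y \<in> core U" using xy by (auto simp: tset_core)
      then have "x \<in> N y" using E N_iff by simp
      then have "bl x = bl y \<or> {bl x, bl y} \<in> g" using g_edge[OF c] by (simp add: mem_cnbhd)
      then show ?thesis
      proof
        assume "{bl x, bl y} \<in> g"
        then show ?thesis using step.IH rep' c by (auto intro: rtrancl_into_rtrancl)
      qed (use step.IH rep' c in simp)
    qed
  qed
  then show "(B, B') \<in> {(x, y). {x, y} \<in> g}\<^sup>*" using uw rep' by simp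
qed

text \<open>By \<open>g_edge\<close>, the set \<open>N u\<close> is read off from the closed
  neighbourhood of the block of \<open>u\<close>; sibling blocks therefore have equal
  \<open>N\<close> and coincide.\<close>

lemma g_M: "g \<in> M_sp (bl ` core U)"
proof -
  have False if h: "u \<in> core U" "v \<in> core U" "bl u \<noteq> bl v" "cnbhd g (bl u) = cnbhd g (bl v)" for u v
  proof -
    have "w \<in> N u \<longleftrightarrow> w \<in> N v" if "w \<in> core U" for w
      using g_edge[OF that h(1)] g_edge[OF that h(2)] h(4) by simp
    then have "N u = N v" using N_core by blast
    then show False using h twin_block_cong by blast
  qed
  then show ?thesis using g_connected by (auto simp: M_sp_def has_sibling_def)
qed

text \<open>Without neighbours in \<open>s2 U\<close> the closed neighbourhood lies inside the core
  and equals \<open>N\<close>, so two such vertices of one class are siblings before the deletion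
  too.\<close>

lemma twin_class_untufted:
  assumes "x \<in> twin_class U E v - tufted U E" "y \<in> twin_class U E v - tufted U E" "x \<noteq> y"
  shows "x \<in> s3 U"
proof -
  have c: "cnbhd E z = N z" if "z \<in> twin_class U E v - tufted U E" for z
  proof -
    have "z \<in> core U" "nbhd E z \<inter> s2 U = {}" using that by (auto simp: twin_class_iff tufted_def)
    then show ?thesis using graph_on_nbhd[OF gr, of z] by (auto simp: core_cnbhd_def cnbhd_def tset_core)
  qed
  show ?thesis
    using assms c[of x] c[of y]
    by (intro patch_graph_s3I[OF PG, of x y]) (auto simp: twin_class_iff tufted_def)
qed

text \<open>A sibling survives the deletion as a member of the same class. If it carried a Y-leaf,
  this leaf would also be a neighbour of \<open>x\<close>.\<close>

lemma s3_sibling: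
  assumes "x \<in> s3 U" "x \<in> twin_class U E v"
  shows "\<exists>y \<in> twin_class U E v - tufted U E. y \<noteq> x" "x \<notin> tufted U E"
proof -
  show x: "x \<notin> tufted U E" using patch_graph_s3D(1)[OF PG assms(1)] by (auto simp: tufted_def)
  obtain y where y: "y \<in> core U" "y \<noteq> x" "cnbhd E y = cnbhd E x"
    using patch_graph_s3D(2)[OF PG assms(1)] by auto
  have "N y = N x" using y by (simp add: core_cnbhd_def)
  moreover have "y \<notin> tufted U E"
  proof
    assume "y \<in> tufted U E"
    then obtain z where z: "z \<in> s2 U" "z \<in> nbhd E y" by (auto simp: tufted_def)
    then have "z \<in> cnbhd E y" by (simp add: cnbhd_def)
    then have "z \<in> cnbhd E x" using y by simp
    moreover have "x \<in> core U" using assms by (simp add: core_def)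
    ultimately have "z \<in> nbhd E x" using z disj by (auto simp: cnbhd_def)
    then show False using z x \<open>x \<in> core U\<close> by (auto simp: tufted_def)
  qed
  ultimately show "\<exists>y \<in> twin_class U E v - tufted U E. y \<noteq> x" using y assms by (auto simp: twin_class_iff)
qed

lemma untufted_part_left_ok: "left_ok (untufted_part U E v)"
proof -
  let ?D = "twin_class U E v - tufted U E"
  have D3: "s3 U \<inter> twin_class U E v \<subseteq> ?D" using s3_sibling by auto
  have D: "?D \<subseteq> s1 U \<union> s3 U" by (auto simp: twin_class_iff core_def)
  have fin: "finite ?D" using disj(3) by (auto simp: twin_class_def)
  \<comment> \<open>The class has none, exactly one, or at least two untufted vertices; these cases
    give the shapes of 1, X and sets of at least two labels of sort Z.\<close>
  consider "?D = {}" | x where "?D = {x}" | x y where "x \<in> ?D" "y \<in> ?D" "x \<noteq> y" by blast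
  then show ?thesis
  proof cases
    case 1
    then have "s3 U \<inter> twin_class U E v = {}" "s1 U \<inter> twin_class U E v - tufted U E = {}" using D3 by blast+
    then show ?thesis by (simp add: left_ok_def untufted_part_def)
  next
    case (2 x)
    have "x \<notin> s3 U" using s3_sibling(1)[of x v] 2 by blast
    moreover have "s3 U \<inter> twin_class U E v \<subseteq> {x}" using D3 unfolding 2 .
    moreover have "x \<in> s1 U \<union> s3 U" using D unfolding 2 by simp
    moreover have "s1 U \<inter> twin_class U E v - tufted U E = s1 U \<inter> {x}" unfolding 2[symmetric] by blast
    ultimately have "s3 U \<inter> twin_class U E v = {}" "s1 U \<inter> twin_class U E v - tufted U E = {x}" by auto
    then show ?thesis by (simp add: left_ok_def untufted_part_def)
  next
    case (3 x y)
    have "?D \<subseteq> s3 U"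
    proof
      fix z assume z: "z \<in> ?D"
      show "z \<in> s3 U" using twin_class_untufted[OF z] 3 by metis
    qed
    then have "s3 U \<inter> twin_class U E v = ?D" "s1 U \<inter> twin_class U E v - tufted U E = {}"
      using D3 disj(2) by blast+
    moreover have "2 \<le> card ?D" using card_mono[OF fin, of "{x, y}"] 3 by simp
    ultimately show ?thesis by (simp add: left_ok_def untufted_part_def)
  qed
qed

text \<open>What is left of a block without its untufted part consists of the tufted vertices and
  all leaves of the block. Grouping each leaf with its only neighbour partitions it into
  tufts.\<close>

lemma untufted_part_tufts_P:
  assumes v: "v \<in> core U"
  shows "(untufted_part U E v, tufts U E v) \<in> P_sp (bl v)"
proof -
  have "tset (bl v) \<noteq> {}" using v by (auto simp: tset_core core_twin_block twin_class_iff)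
  moreover have "tri_sub (untufted_part U E v) (bl v)" by (auto simp: tri_sub_def untufted_part_def twin_block_def)
  moreover have "tuft_partition (tufts U E v) (tri_diff (bl v) (untufted_part U E v))"
  proof -
    have d: "tri_diff (bl v) (untufted_part U E v) =
      (twin_class U E v \<inter> tufted U E, {y\<in>s2 U. \<exists>c\<in>twin_class U E v. c \<in> nbhd E y}, {})"
      using tufted_s1 by (auto simp: tri_diff_def twin_block_def untufted_part_def)
    have "tri_partition (tufts U E v) (tri_diff (bl v) (untufted_part U E v))"
      unfolding tri_partition_def d
    proof (intro conjI ballI impI)
      show "finite (tufts U E v)" using disj by (auto simp: tufts_def twin_class_def)
      fix C assume "C \<in> tufts U E v"
      then obtain x where x: "x \<in> twin_class U E v" "x \<in> tufted U E" "C = tuft U E x" by (auto simp: tufts_def)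
      show "tri_sub C (twin_class U E v \<inter> tufted U E, {y \<in> s2 U. \<exists>c\<in>twin_class U E v. c \<in> nbhd E y}, {})"
        using x nbhd_sym[of _ E x] by (auto simp: tri_sub_def tuft_def)
      show "tset C \<noteq> {}" using x by (auto simp: tuft_def tset_def)
      fix C' assume "C' \<in> tufts U E v" "C \<noteq> C'"
      then obtain x' where x': "x' \<in> twin_class U E v" "x' \<in> tufted U E" "C' = tuft U E x'" "x \<noteq> x'"
        using x by (auto simp: tufts_def)
      have "False" if "y \<in> s2 U" "y \<in> nbhd E x" "y \<in> nbhd E x'" for y
        using nbr_s2(1)[of y x] that nbhd_sym[of y E x] nbhd_sym[of y E x'] x'(4) by auto
      moreover have "x \<notin> s2 U" "x' \<notin> s2 U" using x x' disj by (auto simp: twin_class_iff)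
      ultimately show "tset C \<inter> tset C' = {}" using x' x by (auto simp: tset_def tuft_def)
    next
      show "\<Union> (s2 ` tufts U E v) = s2 (twin_class U E v \<inter> tufted U E, {y \<in> s2 U. \<exists>c\<in>twin_class U E v. c \<in> nbhd E y}, {})"
      proof -
        have "y \<in> \<Union> (s2 ` tufts U E v)" if "y \<in> s2 U" "c \<in> twin_class U E v" "c \<in> nbhd E y" for y c
          using nbr_s2(4)[OF that(1,3)] that nbhd_sym[of c E y] by (auto simp: tufts_def tuft_def)
        moreover have "\<exists>c\<in>twin_class U E v. c \<in> nbhd E y" "y \<in> s2 U" if "y \<in> \<Union> (s2 ` tufts U E v)" for y
          using that nbhd_sym[of y E] by (auto simp: tufts_def tuft_def)
        ultimately show ?thesis unfolding s_simps by blast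
      qed
    qed (auto simp: tufts_def tuft_def)
    then show ?thesis by (auto simp: tuft_partition_def tufts_def tuft_def tufted_def)
  qed
  ultimately show ?thesis using untufted_part_left_ok by (simp add: P_sp_def)
qed

lemma decomp_MP: "decomp U E \<in> MP_sp U"
proof -
  have "\<exists>!s. (B, s) \<in> (\<lambda>v. (bl v, (untufted_part U E v, tufts U E v))) ` core U" if B: "B \<in> bl ` core U" for B
  proof -
    obtain v where v: "v \<in> core U" "B = bl v" using B by auto
    show ?thesis
    proof (rule ex1I[of _ "(untufted_part U E v, tufts U E v)"])
      fix s assume "(B, s) \<in> (\<lambda>v. (bl v, (untufted_part U E v, tufts U E v))) ` core U"
      then obtain u where u: "u \<in> core U" "B = bl u" "s = (untufted_part U E u, tufts U E u)" by auto
      then have "N u = N v" using v twin_block_eq_iff by auto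
      then show "s = (untufted_part U E v, tufts U E v)" using u twin_block_cong by blast
    qed (use v in auto)
  qed
  then show ?thesis
    using twin_block_partition g_M untufted_part_tufts_P by (auto simp: decomp_g MP_sp_def)
qed

text \<open>An edge that ends in \<open>s2 U\<close> is a pendant edge of a tuft; any other edge
  lies within one class or between adjacent classes. Conversely, \<open>g_edge\<close> makes
  adjacent classes completely joined in the original graph.\<close>

lemma glue_decomp: "glue (decomp U E) = E"
proof (intro set_eqI iffI)
  fix e assume e: "e \<in> E"
  then obtain u v where uv: "e = {u, v}" "u \<noteq> v" "u \<in> tset U" "v \<in> tset U" "u \<in> nbhd E v" "v \<in> nbhd E u"
    using graph_on_edgeE[OF gr e] by (metis mem_nbhd insert_commute)
  have tuft: "{c, y} \<in> glue (decomp U E)" if y: "y \<in> s2 U" "c \<in> nbhd E y" for c y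
  proof -
    note n = nbr_s2[OF y]
    have "tuft U E c \<in> tufts U E c" using n by (auto simp: tufts_def twin_class_iff)
    moreover have "c \<in> s1 (tuft U E c)" "y \<in> s2 (tuft U E c)" using y nbhd_sym[of c E y] by (auto simp: tuft_def)
    moreover have "c \<noteq> y" using y graph_on_nbhd[OF gr, of y] by auto
    ultimately show ?thesis using n(3) unfolding decomp_g by (intro glue_tuftI) auto
  qed
  show "e \<in> glue (decomp U E)"
  proof (cases "u \<in> s2 U \<or> v \<in> s2 U")
    case True
    then show ?thesis using tuft[of u v] tuft[of v u] uv by (auto simp: insert_commute)
  next
    case False
    then have c: "u \<in> core U" "v \<in> core U" using uv by (auto simp: tset_core)
    then have in_core: "u \<in> core (bl u)" "v \<in> core (bl v)" by (auto simp: core_twin_block twin_class_iff)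
    have "u \<in> N v" using e uv c N_iff by simp
    then have "bl u = bl v \<or> {bl u, bl v} \<in> g" using g_edge[OF c] by (simp add: mem_cnbhd)
    then show ?thesis
    proof
      assume "bl u = bl v"
      then show ?thesis unfolding decomp_g uv(1) using in_core c uv(2) by (intro glue_blockI[of "bl u"]) simp_all
    next
      assume "{bl u, bl v} \<in> g"
      then show ?thesis unfolding decomp_g uv(1) using in_core uv(2) by (intro glue_edgeI)
    qed
  qed
next
  fix e assume "e \<in> glue (decomp U E)"
  then show "e \<in> E" unfolding decomp_g
  proof (cases rule: glueE)
    case (block u v B)
    then have "u \<in> core U" "N u = N v" by (auto simp: core_twin_block twin_class_iff)
    then have "u \<in> core U" "u \<in> N v" using N_refl by auto
    then show ?thesis using block N_iff by auto
  next
    case (edge u v B B')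
    then have "B \<in> bl ` core U" "B' \<in> bl ` core U" using graph_on_edgeD[OF g_graph] by blast+
    then obtain a b where "B = bl a" "B' = bl b" by auto
    then have c: "u \<in> core U" "v \<in> core U" "B = bl u" "B' = bl v"
      using edge(4,5) twin_block_cong[of u a] twin_block_cong[of v b] by (auto simp: core_twin_block twin_class_iff)
    then have "bl u \<in> cnbhd g (bl v)" using edge(3) by (simp add: mem_cnbhd)
    then have "u \<in> N v" using g_edge c by simp
    then show ?thesis using edge(1,2) N_iff c by auto
  next
    case tuft
    then show ?thesis by (auto simp: tufts_def tuft_def mem_nbhd insert_commute)
  qed
qed

end

text \<open>Tufts contain no label of sort 3, so all of these lie in \<open>W\<close>, which in turn
  contains none of sort 2. The core of a block is nonempty because a label of sort 2 lies in a tuft,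
  whose centre has sort 1.\<close>

lemma P_spD:
  assumes "(W, \<tau>) \<in> P_sp B"
  shows "tri_sub W B" "left_ok W" "s2 W = {}" "s3 W = s3 B" "core B \<noteq> {}"
    "\<And>C. C \<in> \<tau> \<Longrightarrow> \<exists>c. s1 C = {c} \<and> c \<in> s1 B \<and> c \<notin> s1 W \<and> s2 C \<noteq> {} \<and> s2 C \<subseteq> s2 B \<and> s3 C = {}"
    "\<And>C C'. C \<in> \<tau> \<Longrightarrow> C' \<in> \<tau> \<Longrightarrow> C \<noteq> C' \<Longrightarrow> s1 C \<inter> s1 C' = {} \<and> s2 C \<inter> s2 C' = {}"
    "\<And>x. x \<in> s1 B \<Longrightarrow> x \<notin> s1 W \<Longrightarrow> \<exists>C\<in>\<tau>. s1 C = {x}"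
    "\<And>y. y \<in> s2 B \<Longrightarrow> \<exists>C\<in>\<tau>. y \<in> s2 C"
proof -
  have W: "tset B \<noteq> {}" "tri_sub W B" "left_ok W" and t: "tuft_partition \<tau> (tri_diff B W)"
    using assms by (auto simp: P_sp_def)
  then show "tri_sub W B" "left_ok W" by auto
  show W2: "s2 W = {}" using W by (auto simp: left_ok_def)
  have tp: "tri_partition \<tau> (s1 B - s1 W, s2 B, s3 B - s3 W)"
    using t W2 by (simp add: tuft_partition_def tri_diff_def)
  have C: "card (s1 C) = 1" "s2 C \<noteq> {}" "s3 C = {}" if "C \<in> \<tau>" for C
    using t that by (auto simp: tuft_partition_def)
  have un: "\<Union> (s1 ` \<tau>) = s1 B - s1 W" "\<Union> (s2 ` \<tau>) = s2 B" "\<Union> (s3 ` \<tau>) = s3 B - s3 W"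
    using tp by (auto simp: tri_partition_def)
  have "s3 B \<subseteq> s3 W" using un(3) C(3) by blast
  moreover have "s3 W \<subseteq> s3 B" using W by (simp add: tri_sub_def)
  ultimately show "s3 W = s3 B" by blast
  show Cc: "\<exists>c. s1 C = {c} \<and> c \<in> s1 B \<and> c \<notin> s1 W \<and> s2 C \<noteq> {} \<and> s2 C \<subseteq> s2 B \<and> s3 C = {}" if c: "C \<in> \<tau>" for C
  proof -
    obtain c where "s1 C = {c}" using C(1)[OF c] by (auto simp: card_1_singleton_iff)
    moreover have "s1 C \<subseteq> s1 B - s1 W" "s2 C \<subseteq> s2 B" using c un by blast+
    ultimately show ?thesis using C[OF c] by auto
  qed
  show "s1 C \<inter> s1 C' = {} \<and> s2 C \<inter> s2 C' = {}" if "C \<in> \<tau>" "C' \<in> \<tau>" "C \<noteq> C'" for C C'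
  proof -
    have "tset C \<inter> tset C' = {}" using tp that by (simp add: tri_partition_def)
    then show ?thesis by (auto simp: tset_def)
  qed
  show "\<exists>C\<in>\<tau>. s1 C = {x}" if x: "x \<in> s1 B" "x \<notin> s1 W" for x
  proof -
    obtain D where "D \<in> \<tau>" "x \<in> s1 D" using x un(1) by blast
    then show ?thesis using Cc[of D] by auto
  qed
  show sy: "\<exists>C\<in>\<tau>. y \<in> s2 C" if "y \<in> s2 B" for y using that un(2) by blast
  show "core B \<noteq> {}"
  proof (cases "s2 B = {}")
    case True
    then show ?thesis using W by (auto simp: tset_core)
  next
    case False
    then obtain C where "C \<in> \<tau>" using sy by blast
    then show ?thesis using Cc[of C] by (auto simp: core_def)
  qed
qed

section \<open>From a co-mating graph of patches to a graph\<close>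

locale patchwork =
  fixes U :: "'a tri" and \<pi> :: "'a tri set" and g :: "'a tri set set" and p :: "('a tri \<times> 'a P_str) set"
  assumes ok: "tri_ok U" and MP: "(\<pi>, g, p) \<in> MP_sp U"
begin

text \<open>The relation \<open>p\<close> has exactly one value on each block of the partition, so
  the description is meaningful there; elsewhere the value is arbitrary.\<close>

definition "W B = fst (THE s. (B, s) \<in> p)"
definition "T B = snd (THE s. (B, s) \<in> p)"
abbreviation "E \<equiv> glue (\<pi>, g, p)"

lemmas disj = tri_ok_disjoint[OF ok]

lemma part: "tri_partition \<pi> U" and gM: "g \<in> M_sp \<pi>" and p_sub: "p \<subseteq> Sigma \<pi> P_sp"
  and p_fun: "\<And>B. B \<in> \<pi> \<Longrightarrow> \<exists>!s. (B, s) \<in> p"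
  using MP by (auto simp: MP_sp_def)

lemma gcon: "connected_graph \<pi> g"
  using gM by (simp add: M_sp_def)

lemma ggr: "graph_on \<pi> g"
  using gcon by (simp add: connected_graph_def)

lemma p_iff: "(B, s) \<in> p \<longleftrightarrow> B \<in> \<pi> \<and> s = (W B, T B)"
proof -
  have "(B, s) \<in> p \<longleftrightarrow> s = (W B, T B)" if "B \<in> \<pi>"
    using theI'[OF p_fun[OF that]] p_fun[OF that] by (auto simp: W_def T_def)
  then show ?thesis using p_sub by blast
qed

lemma P: "B \<in> \<pi> \<Longrightarrow> (W B, T B) \<in> P_sp B"
  using p_iff[of B "(W B, T B)"] p_sub by blast

lemma block_sub: "B \<in> \<pi> \<Longrightarrow> s1 B \<subseteq> s1 U \<and> s2 B \<subseteq> s2 U \<and> s3 B \<subseteq> s3 U \<and> core B \<subseteq> core U"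
  using part by (auto simp: tri_partition_def tri_sub_def core_def)

lemma block_disj: "B \<in> \<pi> \<Longrightarrow> B' \<in> \<pi> \<Longrightarrow> x \<in> tset B \<Longrightarrow> x \<in> tset B' \<Longrightarrow> B = B'"
  using part by (auto simp: tri_partition_def)

lemma core_disj: "B \<in> \<pi> \<Longrightarrow> B' \<in> \<pi> \<Longrightarrow> x \<in> core B \<Longrightarrow> x \<in> core B' \<Longrightarrow> B = B'"
  using block_disj[of B B' x] by (simp add: tset_core)

lemma s2_disj: "B \<in> \<pi> \<Longrightarrow> B' \<in> \<pi> \<Longrightarrow> x \<in> s2 B \<Longrightarrow> x \<in> s2 B' \<Longrightarrow> B = B'"
  using block_disj[of B B' x] by (simp add: tset_core)

lemma block_un: "\<Union> (s1 ` \<pi>) = s1 U" "\<Union> (s2 ` \<pi>) = s2 U" "\<Union> (s3 ` \<pi>) = s3 U"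
  using part by (auto simp: tri_partition_def)

lemma core_block: "v \<in> core U \<Longrightarrow> \<exists>B\<in>\<pi>. v \<in> core B"
  unfolding core_def block_un[symmetric] by blast

lemma s1_core: "B \<in> \<pi> \<Longrightarrow> x \<in> core B \<Longrightarrow> x \<in> s1 U \<Longrightarrow> x \<in> s1 B"
  using block_sub[of B] disj(2) by (auto simp: core_def)

lemma s3_core: "B \<in> \<pi> \<Longrightarrow> x \<in> core B \<Longrightarrow> x \<in> s3 U \<Longrightarrow> x \<in> s3 B"
  using block_sub[of B] disj(2) by (auto simp: core_def)

lemma s2_tuft:
  assumes "y \<in> s2 U"
  obtains B C c where "B \<in> \<pi>" "C \<in> T B" "y \<in> s2 C" "s1 C = {c}" "c \<in> s1 B" "y \<in> s2 B" "c \<notin> s1 (W B)"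
proof -
  obtain B where B: "B \<in> \<pi>" "y \<in> s2 B" using assms block_un by blast
  obtain C where C: "C \<in> T B" "y \<in> s2 C" using P_spD(9)[OF P[OF B(1)] B(2)] by blast
  obtain c where "s1 C = {c}" "c \<in> s1 B" "c \<notin> s1 (W B)" using P_spD(6)[OF P[OF B(1)] C(1)] by blast
  from B(1) C this(1,2) B(2) this(3) show thesis by (rule that)
qed

lemma tuft_facts:
  assumes "B \<in> \<pi>" "C \<in> T B"
  shows "s2 C \<subseteq> s2 B" "s2 C \<subseteq> s2 U" "s1 C \<subseteq> s1 B" "s1 C \<subseteq> core U"
  using P_spD(6)[OF P[OF assms(1)] assms(2)] block_sub[OF assms(1)] by (auto simp: core_def)

lemma tuft_unique:
  assumes "B \<in> \<pi>" "C \<in> T B" "B' \<in> \<pi>" "C' \<in> T B'" "y \<in> s2 C \<and> y \<in> s2 C' \<or> y \<in> s1 C \<and> y \<in> s1 C'"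
  shows "B = B'" "C = C'"
proof -
  have "y \<in> s2 B \<and> y \<in> s2 B' \<or> y \<in> core B \<and> y \<in> core B'"
    using assms tuft_facts(1,3)[OF assms(1,2)] tuft_facts(1,3)[OF assms(3,4)] by (auto simp: core_def)
  then show "B = B'" using s2_disj core_disj assms by blast
  then show "C = C'" using P_spD(7)[OF P[OF assms(1)], of C C'] assms by blast
qed

text \<open>Pendant edges end in sort 2 and cannot join two core vertices. As distinct blocks have
  disjoint cores, a clique or join edge determines the blocks of its ends.\<close>

lemma adj_core:
  assumes "B \<in> \<pi>" "B' \<in> \<pi>" "u \<in> core B" "v \<in> core B'"
  shows "{u, v} \<in> E \<longleftrightarrow> u \<noteq> v \<and> B' \<in> cnbhd g B"
proof
  have U: "u \<in> core U" "v \<in> core U" "u \<notin> s2 U" "v \<notin> s2 U" using assms block_sub disj(1) by blast+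
  assume "{u, v} \<in> E"
  then show "u \<noteq> v \<and> B' \<in> cnbhd g B"
  proof (cases rule: glueE)
    case (block a b D)
    then have "u \<in> core D" "v \<in> core D" "u \<noteq> v" by (auto simp: doubleton_eq_iff)
    then have "B = D" "B' = D" using core_disj assms block by blast+
    then show ?thesis using \<open>u \<noteq> v\<close> by (simp add: mem_cnbhd)
  next
    case (edge a b D D')
    then have D: "D \<in> \<pi>" "D' \<in> \<pi>" using graph_on_edgeD[OF ggr] by blast+
    from edge(1) have "u = a \<and> v = b \<or> u = b \<and> v = a" by (auto simp: doubleton_eq_iff)
    then have "u \<noteq> v \<and> (B = D \<and> B' = D' \<or> B = D' \<and> B' = D)"
      using edge(2,4,5) core_disj assms D by blast
    then show ?thesis using edge(3) by (auto simp: mem_cnbhd insert_commute)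
  next
    case (tuft a b D W' \<tau> C)
    then have "b \<in> s2 U" using tuft_facts[of D C] by (auto simp: p_iff)
    moreover have "b = u \<or> b = v" using tuft(1) by auto
    ultimately show ?thesis using U by auto
  qed
next
  assume h: "u \<noteq> v \<and> B' \<in> cnbhd g B"
  then consider "B' = B" | "{B', B} \<in> g" by (auto simp: mem_cnbhd)
  then show "{u, v} \<in> E"
  proof cases
    case 1
    then show ?thesis using h assms by (intro glue_blockI[of B]) auto
  next
    case 2
    then show ?thesis using h assms by (intro glue_edgeI[of B B']) (auto simp: insert_commute)
  qed
qed

text \<open>Clique and join edges stay inside the core, and tufts are disjoint, within a block as
  well as across blocks; only the edge to the centre of its own tuft reaches
  \<open>y\<close>.\<close>

lemma nbhd_s2:
  assumes "B \<in> \<pi>" "C \<in> T B" "y \<in> s2 C" "s1 C = {c}"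
  shows "nbhd E y = {c}"
proof -
  have y: "y \<in> s2 U" "y \<notin> core U" "c \<in> core U" using tuft_facts[OF assms(1,2)] assms(3,4) disj(1) by auto
  have "{c, y} \<in> E" using assms y p_iff[of B] by (intro glue_tuftI[of B "W B" "T B" _ C]) auto
  moreover have "u = c" if "{u, y} \<in> E" for u
    using that
  proof (cases rule: glueE)
    case (block a b D)
    then have "a \<in> core U" "b \<in> core U" using block_sub by blast+
    moreover have "y = a \<or> y = b" using block(1) by auto
    ultimately show ?thesis using y by auto
  next
    case (edge a b D D')
    then have D: "D \<in> \<pi>" "D' \<in> \<pi>" using graph_on_edgeD[OF ggr] by blast+
    then have "a \<in> core U" "b \<in> core U" using block_sub edge by blast+
    moreover have "y = a \<or> y = b" using edge(1) by auto
    ultimately show ?thesis using y by auto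
  next
    case (tuft a b D W' \<tau> C')
    then have D: "D \<in> \<pi>" "C' \<in> T D" by (auto simp: p_iff)
    then have "a \<in> core U" using tuft_facts(4) tuft(5) by blast
    then have "y = b" "u = a" using tuft(1) y by (auto simp: doubleton_eq_iff)
    then have "C = C'" using tuft_unique(2)[OF assms(1,2) D, of y] assms(3) tuft(6) by blast
    then show ?thesis using assms(4) tuft(5) \<open>u = a\<close> by auto
  qed
  ultimately have "x \<in> nbhd E y \<longleftrightarrow> x = c" for x unfolding mem_nbhd by metis
  then show ?thesis by blast
qed

lemma nbhd_tufted:
  assumes "B \<in> \<pi>" "C \<in> T B" "s1 C = {c}"
  shows "nbhd E c \<inter> s2 U = s2 C"
proof
  have "y \<in> nbhd E c" if "y \<in> s2 C" for y
    using nbhd_s2[OF assms(1,2) that assms(3)] nbhd_sym[of c E y] by simp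
  then show "s2 C \<subseteq> nbhd E c \<inter> s2 U" using tuft_facts(2)[OF assms(1,2)] by blast
  show "nbhd E c \<inter> s2 U \<subseteq> s2 C"
  proof
    fix y assume y: "y \<in> nbhd E c \<inter> s2 U"
    then have "y \<in> s2 U" by simp
    then obtain B' C' c' where *: "B' \<in> \<pi>" "C' \<in> T B'" "y \<in> s2 C'" "s1 C' = {c'}" by (rule s2_tuft)
    have "c \<in> nbhd E y" using y nbhd_sym[of y E c] by simp
    then have "c = c'" using nbhd_s2[OF *] by simp
    then have "C = C'" using tuft_unique(2)[OF assms(1,2) *(1,2), of c] assms * by simp
    then show "y \<in> s2 C" using * by simp
  qed
qed

text \<open>The labels of sort 1 outside \<open>W B\<close> are the centres of the tufts, and every
  tuft has at least one leaf. This recovers the first factor of the patch from the graph.\<close>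

lemma tufted_iff:
  assumes "B \<in> \<pi>" "v \<in> core B"
  shows "v \<in> tufted U E \<longleftrightarrow> v \<in> s1 B \<and> v \<notin> s1 (W B)"
proof
  assume "v \<in> tufted U E"
  then obtain y where y: "y \<in> s2 U" "v \<in> nbhd E y" using nbhd_sym[of _ E v] by (auto simp: tufted_def)
  obtain B' C c where *: "B' \<in> \<pi>" "C \<in> T B'" "y \<in> s2 C" "s1 C = {c}" "c \<in> s1 B'" "c \<notin> s1 (W B')"
    using y(1) by (rule s2_tuft)
  have "v = c" using nbhd_s2[OF *(1-4)] y by simp
  then have "v \<in> core B'" using * by (simp add: core_def)
  then have "B = B'" using core_disj assms * by blast
  then show "v \<in> s1 B \<and> v \<notin> s1 (W B)" using * \<open>v = c\<close> by simp
next
  assume "v \<in> s1 B \<and> v \<notin> s1 (W B)"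
  then obtain C where C: "C \<in> T B" "s1 C = {v}" using P_spD(8)[OF P[OF assms(1)]] by blast
  have "s2 C \<noteq> {}" using P_spD(6)[OF P[OF assms(1)] C(1)] by blast
  moreover have "v \<in> core U" using block_sub assms by blast
  ultimately show "v \<in> tufted U E" using nbhd_tufted[OF assms(1) C] by (simp add: tufted_def)
qed

lemma core_cnbhd_iff:
  assumes "B \<in> \<pi>" "B' \<in> \<pi>" "u \<in> core B" "v \<in> core B'"
  shows "v \<in> core_cnbhd U E u \<longleftrightarrow> B' \<in> cnbhd g B"
proof -
  have "v \<in> core U" using block_sub assms by blast
  then have "v \<in> core_cnbhd U E u \<longleftrightarrow> v = u \<or> {u, v} \<in> E" by (auto simp: core_cnbhd_def mem_cnbhd insert_commute)
  also have "\<dots> \<longleftrightarrow> v = u \<or> B' \<in> cnbhd g B" using adj_core[OF assms] by auto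
  \<comment> \<open>The alternative \<open>v = u\<close> is absorbed, since it makes the two blocks
    equal.\<close>
  also have "\<dots> \<longleftrightarrow> B' \<in> cnbhd g B" using core_disj[OF assms(1,2), of u] assms(3,4) by (auto simp: mem_cnbhd)
  finally show ?thesis .
qed

lemma cnbhd_g_sub: "B \<in> \<pi> \<Longrightarrow> cnbhd g B \<subseteq> \<pi>"
  using graph_on_nbhd[OF ggr, of B] by (auto simp: cnbhd_def)

text \<open>This is where the absence of siblings in \<open>g\<close> is used. Every block has a
  core vertex, so equal core neighbourhoods give equal closed neighbourhoods of the blocks in
  \<open>g\<close>, and then the blocks themselves are equal. It follows that the twin classes are
  exactly the cores of the blocks.\<close>

lemma core_cnbhd_eq_iff:
  assumes "B \<in> \<pi>" "B' \<in> \<pi>" "u \<in> core B" "v \<in> core B'"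
  shows "core_cnbhd U E u = core_cnbhd U E v \<longleftrightarrow> B = B'"
proof
  assume "B = B'"
  have "x \<in> core_cnbhd U E u \<longleftrightarrow> x \<in> core_cnbhd U E v" if x: "x \<in> core U" for x
  proof -
    obtain D where D: "D \<in> \<pi>" "x \<in> core D" using core_block[OF x] by blast
    show ?thesis
      using core_cnbhd_iff[OF assms(1) D(1) assms(3) D(2)] core_cnbhd_iff[OF assms(2) D(1) assms(4) D(2)] \<open>B = B'\<close> by simp
  qed
  moreover have "core_cnbhd U E w \<subseteq> core U" for w by (simp add: core_cnbhd_def)
  ultimately show "core_cnbhd U E u = core_cnbhd U E v" by blast
next
  assume eq: "core_cnbhd U E u = core_cnbhd U E v"
  have "D \<in> cnbhd g B \<longleftrightarrow> D \<in> cnbhd g B'" if D: "D \<in> \<pi>" for D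
  proof -
    obtain x where x: "x \<in> core D" using P_spD(5)[OF P[OF D]] by blast
    show ?thesis
      using core_cnbhd_iff[OF assms(1) D assms(3) x] core_cnbhd_iff[OF assms(2) D assms(4) x] eq by simp
  qed
  then have "cnbhd g B = cnbhd g B'" using cnbhd_g_sub assms by blast
  then show "B = B'" using gM assms by (auto simp: M_sp_def has_sibling_def)
qed

lemma twin_class_block:
  assumes "B \<in> \<pi>" "v \<in> core B"
  shows "twin_class U E v = core B"
proof
  show "twin_class U E v \<subseteq> core B"
  proof
    fix x assume x: "x \<in> twin_class U E v"
    then have "x \<in> core U" by (simp add: twin_class_def)
    then obtain D where D: "D \<in> \<pi>" "x \<in> core D" using core_block by blast
    then have "D = B" using core_cnbhd_eq_iff[OF D(1) assms(1) D(2) assms(2)] x by (simp add: twin_class_def)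
    then show "x \<in> core B" using D by simp
  qed
  show "core B \<subseteq> twin_class U E v"
    using core_cnbhd_eq_iff[OF assms(1,1) _ assms(2)] block_sub[OF assms(1)] by (auto simp: twin_class_def)
qed

text \<open>The core labels are recovered as a twin class, and the leaves because each hangs on a
  centre in its own block.\<close>

lemma twin_block_block:
  assumes "B \<in> \<pi>" "v \<in> core B"
  shows "twin_block U E v = B"
proof (rule tri_eqI)
  note c = twin_class_block[OF assms]
  have sub: "s1 B \<subseteq> s1 U" "s3 B \<subseteq> s3 U" "core B = s1 B \<union> s3 B" using block_sub[OF assms(1)] by (auto simp: core_def)
  then show "s1 (twin_block U E v) = s1 B" "s3 (twin_block U E v) = s3 B"
    using disj(2) unfolding twin_block_def c s_simps by blast+
  show "s2 (twin_block U E v) = s2 B"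
  proof -
    have "y \<in> s2 B \<longleftrightarrow> (\<exists>c\<in>core B. c \<in> nbhd E y)" if y: "y \<in> s2 U" for y
    proof -
      obtain B' C c where *: "B' \<in> \<pi>" "C \<in> T B'" "y \<in> s2 C" "s1 C = {c}" "c \<in> s1 B'" "y \<in> s2 B'"
        using y by (rule s2_tuft)
      have "y \<in> s2 B \<longleftrightarrow> B = B'" using s2_disj[OF assms(1) *(1) _ *(6)] *(6) by auto
      moreover have "c \<in> core B'" using * by (simp add: core_def)
      then have "c \<in> core B \<longleftrightarrow> B = B'" using core_disj[OF assms(1) *(1)] by auto
      ultimately show ?thesis using nbhd_s2[OF *(1-4)] by auto
    qed
    then show ?thesis using block_sub[OF assms(1)] unfolding twin_block_def c s_simps by blast
  qed
qed

lemma W_facts: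
  assumes "B \<in> \<pi>"
  shows "W B = (s1 B \<inter> s1 (W B), {}, s3 B)"
  using P_spD(1,3,4)[OF P[OF assms]] by (intro tri_eqI) (auto simp: tri_sub_def)

lemma untufted_part_block:
  assumes "B \<in> \<pi>" "v \<in> core B"
  shows "untufted_part U E v = W B"
proof -
  have "x \<in> s1 U \<inter> core B - tufted U E \<longleftrightarrow> x \<in> s1 B \<inter> s1 (W B)" for x
    using tufted_iff[OF assms(1), of x] s1_core[OF assms(1), of x] block_sub[OF assms(1)] by (auto simp: core_def)
  moreover have "s3 U \<inter> core B = s3 B"
    using s3_core[OF assms(1)] block_sub[OF assms(1)] by (auto simp: core_def)
  ultimately show ?thesis using twin_class_block[OF assms] by (subst W_facts[OF assms(1)]) (simp add: untufted_part_def set_eq_iff)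
qed

lemma tufts_block:
  assumes "B \<in> \<pi>" "v \<in> core B"
  shows "tufts U E v = T B"
proof -
  have tu: "tuft U E c = C" if "C \<in> T B" "s1 C = {c}" for C c
  proof -
    have "s3 C = {}" using P_spD(6)[OF P[OF assms(1)] that(1)] by blast
    then show ?thesis
      using nbhd_tufted[OF assms(1) that] that by (intro tri_eqI) (auto simp: tuft_def)
  qed
  show ?thesis unfolding tufts_def twin_class_block[OF assms]
  proof
    show "tuft U E ` (core B \<inter> tufted U E) \<subseteq> T B"
    proof
      fix C assume "C \<in> tuft U E ` (core B \<inter> tufted U E)"
      then obtain x where x: "x \<in> core B" "x \<in> tufted U E" "C = tuft U E x" by auto
      then have "x \<in> s1 B" "x \<notin> s1 (W B)" using tufted_iff[OF assms(1)] by auto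
      then obtain D where "D \<in> T B" "s1 D = {x}" using P_spD(8)[OF P[OF assms(1)]] by blast
      then show "C \<in> T B" using tu x by simp
    qed
    show "T B \<subseteq> tuft U E ` (core B \<inter> tufted U E)"
    proof
      fix C assume C: "C \<in> T B"
      then obtain c where c: "s1 C = {c}" "c \<in> s1 B" "c \<notin> s1 (W B)" using P_spD(6)[OF P[OF assms(1)]] by blast
      then have "c \<in> core B" by (simp add: core_def)
      then have "c \<in> core B \<inter> tufted U E" using tufted_iff[OF assms(1)] c by simp
      then show "C \<in> tuft U E ` (core B \<inter> tufted U E)" using tu[OF C c(1)] by (metis imageI)
    qed
  qed
qed

lemma decomp_glue: "decomp U E = (\<pi>, g, p)"
proof -
  have bl: "\<exists>v\<in>core U. v \<in> core B" if B: "B \<in> \<pi>" for B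
    using P_spD(5)[OF P[OF B]] block_sub[OF B] by blast
  have "twin_block U E ` core U = \<pi>"
  proof
    show "twin_block U E ` core U \<subseteq> \<pi>"
    proof
      fix D assume "D \<in> twin_block U E ` core U"
      then obtain v where v: "v \<in> core U" "D = twin_block U E v" by blast
      then obtain B where "B \<in> \<pi>" "v \<in> core B" using core_block by blast
      then show "D \<in> \<pi>" using v twin_block_block by simp
    qed
    show "\<pi> \<subseteq> twin_block U E ` core U"
    proof
      fix B assume B: "B \<in> \<pi>"
      then obtain v where v: "v \<in> core U" "v \<in> core B" using bl by blast
      show "B \<in> twin_block U E ` core U" using twin_block_block[OF B v(2), symmetric] v(1) by (rule image_eqI)
    qed
  qed
  moreover have "(\<lambda>(u, v). {twin_block U E u, twin_block U E v}) `
       {(u, v). u \<in> core U \<and> v \<in> core U \<and> {u, v} \<in> E \<and> core_cnbhd U E u \<noteq> core_cnbhd U E v} = g" (is "?g = g")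
  proof
    show "?g \<subseteq> g"
    proof
      fix e assume "e \<in> ?g"
      then obtain u v where uv: "u \<in> core U" "v \<in> core U" "{u, v} \<in> E" "core_cnbhd U E u \<noteq> core_cnbhd U E v"
        "e = {twin_block U E u, twin_block U E v}" by blast
      obtain B B' where B: "B \<in> \<pi>" "u \<in> core B" "B' \<in> \<pi>" "v \<in> core B'" using core_block uv by meson
      have "B \<noteq> B'" using uv(4) core_cnbhd_eq_iff[OF B(1,3,2,4)] by blast
      moreover have "B' \<in> cnbhd g B" using adj_core[OF B(1,3,2,4)] uv(3) by blast
      ultimately have "{B', B} \<in> g" by (auto simp: mem_cnbhd)
      then show "e \<in> g" using uv(5) twin_block_block B by (simp add: insert_commute)
    qed
    show "g \<subseteq> ?g"
    proof
      fix e assume e: "e \<in> g"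
      then obtain B B' where B: "e = {B, B'}" "B \<noteq> B'" "B \<in> \<pi>" "B' \<in> \<pi>" by (rule graph_on_edgeE[OF ggr])
      obtain u v where uv: "u \<in> core U" "u \<in> core B" "v \<in> core U" "v \<in> core B'" using bl B by meson
      have "u \<noteq> v" using B core_disj uv by blast
      moreover have "B' \<in> cnbhd g B" using B e by (auto simp: mem_cnbhd insert_commute)
      ultimately have "{u, v} \<in> E" using adj_core[OF B(3,4) uv(2,4)] by blast
      moreover have "core_cnbhd U E u \<noteq> core_cnbhd U E v" using core_cnbhd_eq_iff[OF B(3,4) uv(2,4)] B by blast
      moreover have "e = {twin_block U E u, twin_block U E v}" using twin_block_block B uv by simp
      ultimately show "e \<in> ?g" using uv by blast
    qed
  qed
  moreover have "(\<lambda>v. (twin_block U E v, (untufted_part U E v, tufts U E v))) ` core U = p" (is "?p = p")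
  proof
    have eq: "(twin_block U E v, (untufted_part U E v, tufts U E v)) = (B, (W B, T B))" if "B \<in> \<pi>" "v \<in> core B" for B v
      using twin_block_block[OF that] untufted_part_block[OF that] tufts_block[OF that] by simp
    show "?p \<subseteq> p"
    proof
      fix q assume "q \<in> ?p"
      then obtain v where v: "v \<in> core U" "q = (twin_block U E v, (untufted_part U E v, tufts U E v))" by blast
      then obtain B where "B \<in> \<pi>" "v \<in> core B" using core_block by blast
      then show "q \<in> p" using v eq p_iff by simp
    qed
    show "p \<subseteq> ?p"
    proof
      fix q assume q: "q \<in> p"
      obtain B s where Bs: "q = (B, s)" by (cases q)
      then have B: "B \<in> \<pi>" "q = (B, (W B, T B))" using q p_iff by auto
      then obtain v where v: "v \<in> core U" "v \<in> core B" using bl by blast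
      then have "q = (twin_block U E v, (untufted_part U E v, tufts U E v))" using eq[OF B(1)] B(2) by simp
      then show "q \<in> ?p" using v(1) by (rule image_eqI)
    qed
  qed
  ultimately show ?thesis unfolding decomp_def by simp
qed

lemma glue_graph: "graph_on (tset U) E"
  unfolding graph_on_def
proof (intro conjI ballI)
  show "finite (tset U)" using ok by (simp add: tri_ok_def)
  fix e assume "e \<in> E"
  then have "\<exists>u v. e = {u, v} \<and> u \<noteq> v \<and> u \<in> tset U \<and> v \<in> tset U"
  proof (cases rule: glueE)
    case (block u v B)
    then have "u \<in> tset U" "v \<in> tset U" using block_sub[of B] by (auto simp: tset_core)
    with block show ?thesis by blast
  next
    case (edge u v B B')
    then have D: "B \<in> \<pi>" "B' \<in> \<pi>" using graph_on_edgeD[OF ggr] by blast+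
    then have "u \<in> tset U" "v \<in> tset U" using edge block_sub[of B] block_sub[of B'] by (auto simp: tset_core)
    with edge show ?thesis by blast
  next
    case (tuft u v B W' \<tau> C)
    then have "B \<in> \<pi>" "C \<in> T B" by (auto simp: p_iff)
    then have "u \<in> tset U" "v \<in> tset U" using tuft tuft_facts[of B C] by (auto simp: tset_core)
    with tuft show ?thesis by blast
  qed
  then show "e \<subseteq> tset U" "card e = 2" by auto
qed

text \<open>A walk in \<open>g\<close> lifts to the glued graph, because adjacent cores are
  completely joined and nonempty. The induction reaches all vertices of the current core at once,
  starting from the clique on the first one.\<close>

lemma core_reach:
  assumes "B \<in> \<pi>" "B' \<in> \<pi>" "u \<in> core B" "v \<in> core B'"
  shows "(u, v) \<in> {(x, y). {x, y} \<in> E}\<^sup>*"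
proof -
  have "(B, B') \<in> {(x, y). {x, y} \<in> g}\<^sup>*" using gcon assms by (simp add: connected_graph_def)
  then have "\<forall>v\<in>core B'. (u, v) \<in> {(x, y). {x, y} \<in> E}\<^sup>*"
  proof induction
    case base
    have "{u, v} \<in> E" if "v \<in> core B" "u \<noteq> v" for v
      using that assms by (intro glue_blockI[of B]) auto
    then show ?case by blast
  next
    case (step C D)
    have CD: "C \<in> \<pi>" "D \<in> \<pi>" "C \<noteq> D" using graph_on_edgeD[OF ggr] step(2) by blast+
    obtain w where w: "w \<in> core C" using P_spD(5)[OF P[OF CD(1)]] by blast
    have "{w, x} \<in> E" if x: "x \<in> core D" for x
    proof -
      have "w \<noteq> x" using core_disj CD w x by blast
      then show ?thesis using step(2) w x by (intro glue_edgeI[of C D]) auto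
    qed
    then show ?case using step.IH w by (auto intro: rtrancl_into_rtrancl)
  qed
  then show ?thesis using assms by blast
qed

lemma glue_connected: "connected_graph (tset U) E"
proof -
  have reach: "\<exists>c\<in>core U. (c, v) \<in> {(x, y). {x, y} \<in> E}\<^sup>* \<and> (v, c) \<in> {(x, y). {x, y} \<in> E}\<^sup>*"
    if v: "v \<in> tset U" for v
  proof (cases "v \<in> core U")
    case True
    then show ?thesis by blast
  next
    case False
    then have "v \<in> s2 U" using v by (simp add: tset_core)
    then obtain B C c where *: "B \<in> \<pi>" "C \<in> T B" "v \<in> s2 C" "s1 C = {c}" "c \<in> s1 B" by (rule s2_tuft)
    have "c \<in> nbhd E v" using nbhd_s2[OF *(1-4)] by simp
    then have "{c, v} \<in> E" "{v, c} \<in> E" by (simp_all add: mem_nbhd insert_commute)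
    moreover have "c \<in> core U" using block_sub[OF *(1)] *(5) by (auto simp: core_def)
    ultimately show ?thesis by blast
  qed
  have "(u, v) \<in> {(x, y). {x, y} \<in> E}\<^sup>*" if uv: "u \<in> tset U" "v \<in> tset U" for u v
  proof -
    obtain c d where c: "c \<in> core U" "(u, c) \<in> {(x, y). {x, y} \<in> E}\<^sup>*"
      and d: "d \<in> core U" "(d, v) \<in> {(x, y). {x, y} \<in> E}\<^sup>*" using reach uv by meson
    obtain B D where "B \<in> \<pi>" "c \<in> core B" "D \<in> \<pi>" "d \<in> core D" using core_block c d by meson
    then have "(c, d) \<in> {(x, y). {x, y} \<in> E}\<^sup>*" using core_reach by blast
    with c d show ?thesis by (meson rtrancl_trans)
  qed
  moreover have "tset U \<noteq> {}"
  proof -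
    have "\<pi> \<noteq> {}" using gcon by (simp add: connected_graph_def)
    then obtain B where B: "B \<in> \<pi>" by blast
    then show ?thesis using P_spD(5)[OF P[OF B]] block_sub[OF B] by (auto simp: tset_core)
  qed
  ultimately show ?thesis using glue_graph by (simp add: connected_graph_def)
qed

lemma cnbhd_untufted:
  assumes "v \<in> core U" "v \<notin> tufted U E"
  shows "cnbhd E v = core_cnbhd U E v"
  using assms graph_on_nbhd[OF glue_graph, of v] by (auto simp: core_cnbhd_def cnbhd_def tufted_def tset_core)

text \<open>For sort 3, one direction holds because a block with a label of this sort has at least
  two, all untufted and with equal core neighbourhoods. For the other, a sibling in the core is
  untufted and lies in the same block; if \<open>v\<close> had sort 1, both would lie in
  \<open>s1 (W B)\<close>, which has room for one label only.\<close>

lemma glue_patch_graph: "patch_graph U E"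
proof -
  have "\<exists>c\<in>s1 U. nbhd E y = {c}" if y: "y \<in> s2 U" for y
  proof -
    obtain B C c where *: "B \<in> \<pi>" "C \<in> T B" "y \<in> s2 C" "s1 C = {c}" "c \<in> s1 B" using y by (rule s2_tuft)
    then show ?thesis using nbhd_s2[OF *(1-4)] block_sub[OF *(1)] by blast
  qed
  moreover have "v \<in> s3 U \<longleftrightarrow> v \<in> core U \<and> nbhd E v \<inter> s2 U = {} \<and>
               (\<exists>u\<in>core U. u \<noteq> v \<and> cnbhd E u = cnbhd E v)" (is "_ \<longleftrightarrow> ?R") for v
  proof
    assume v: "v \<in> s3 U"
    then obtain B where B: "B \<in> \<pi>" "v \<in> s3 B" using block_un by blast
    note PB = P_spD[OF P[OF B(1)]]
    \<comment> \<open>A label of sort 3 excludes the shapes of 1 and X in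
      \<open>left_ok\<close>.\<close>
    have "s1 (W B) = {}" "card (s3 B) \<ge> 2" using PB(2,4) B(2) by (auto simp: left_ok_def)
    then have "\<not> s3 B \<subseteq> {v}" using card_mono[of "{v}" "s3 B"] by auto
    then obtain u where u: "u \<in> s3 B" "u \<noteq> v" by blast
    have c: "w \<in> core B" "w \<in> core U" "w \<notin> tufted U E" if "w \<in> s3 B" for w
    proof -
      show 1: "w \<in> core B" using that by (simp add: core_def)
      then show "w \<in> core U" using block_sub B by blast
      have "w \<notin> s1 B" using that block_sub[OF B(1)] disj(2) by blast
      then show "w \<notin> tufted U E" using tufted_iff[OF B(1) 1] by simp
    qed
    have "cnbhd E u = cnbhd E v"
      using cnbhd_untufted c u(1) B(2) core_cnbhd_eq_iff[OF B(1,1), of u v] by simp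
    then show ?R using c[OF B(2)] c[OF u(1)] u(2) unfolding tufted_def by blast
  next
    assume ?R
    then obtain u where v: "v \<in> core U" "nbhd E v \<inter> s2 U = {}" and
      u: "u \<in> core U" "u \<noteq> v" "cnbhd E u = cnbhd E v" by blast
    have tv: "v \<notin> tufted U E" using v by (simp add: tufted_def)
    have tu: "u \<notin> tufted U E"
    proof
      assume "u \<in> tufted U E"
      then obtain y where y: "y \<in> s2 U" "y \<in> nbhd E u" by (auto simp: tufted_def)
      then have "y \<in> cnbhd E u" by (simp add: cnbhd_def)
      then have "y \<in> cnbhd E v" using u by simp
      then have "y \<in> nbhd E v" using y v(1) disj(1) by (auto simp: cnbhd_def)
      then show False using y v by blast
    qed
    obtain B D where B: "B \<in> \<pi>" "v \<in> core B" and D: "D \<in> \<pi>" "u \<in> core D" using core_block v(1) u(1) by meson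
    have "core_cnbhd U E u = core_cnbhd U E v" using u by (simp add: core_cnbhd_def)
    then have "D = B" using core_cnbhd_eq_iff[OF D(1) B(1) D(2) B(2)] by simp
    then have "u \<in> core B" using D by simp
    note PB = P_spD[OF P[OF B(1)]]
    show "v \<in> s3 U"
    proof (rule ccontr)
      assume "v \<notin> s3 U"
      then have "v \<in> s1 B" using B block_sub[OF B(1)] by (auto simp: core_def)
      then have vW: "v \<in> s1 (W B)" using tufted_iff[OF B] tv by simp
      then have W: "card (s1 (W B)) = 1" "s3 B = {}" using PB(2,4) by (auto simp: left_ok_def)
      then have "u \<in> s1 B" using \<open>u \<in> core B\<close> by (simp add: core_def)
      then have "u \<in> s1 (W B)" using tufted_iff[OF B(1) \<open>u \<in> core B\<close>] tu by simp
      then show False using W(1) vW u(2) by (auto simp: card_1_singleton_iff)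
    qed
  qed
  ultimately show ?thesis using glue_connected unfolding patch_graph_def by blast
qed

end

lemma bij_betw_decomp:
  assumes "tri_ok U"
  shows "bij_betw (decomp U) (Collect (patch_graph U)) (MP_sp U)"
proof (rule bij_betw_byWitness[where f' = glue])
  have "glue (decomp U E) = E" "decomp U E \<in> MP_sp U" if "patch_graph U E" for E
  proof -
    interpret patched U E using assms that by unfold_locales
    show "glue (decomp U E) = E" "decomp U E \<in> MP_sp U" by (rule glue_decomp decomp_MP)+
  qed
  then show "\<forall>E\<in>Collect (patch_graph U). glue (decomp U E) = E"
    "decomp U ` Collect (patch_graph U) \<subseteq> MP_sp U" by blast+
  have "decomp U (glue m) = m" "patch_graph U (glue m)" if m: "m \<in> MP_sp U" for m
  proof -
    obtain \<pi> g p where eq: "m = (\<pi>, g, p)" by (cases m)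
    interpret patchwork U \<pi> g p using assms m eq by unfold_locales auto
    show "decomp U (glue m) = m" "patch_graph U (glue m)"
      unfolding eq by (rule decomp_glue glue_patch_graph)+
  qed
  then show "\<forall>m\<in>MP_sp U. decomp U (glue m) = m" "glue ` MP_sp U \<subseteq> Collect (patch_graph U)" by blast+
qed

section \<open>Naturality under relabelling\<close>

locale relabelled =
  fixes U :: "'a tri" and E :: "'a set set" and \<sigma> :: "'a \<Rightarrow> 'a"
  assumes gr: "graph_on (tset U) E" and inj: "inj_on \<sigma> (tset U)"
begin

abbreviation "U' \<equiv> tri_img \<sigma> U"
abbreviation "E' \<equiv> (`) \<sigma> ` E"

lemma s_img: "s1 U' = \<sigma> ` s1 U" "s2 U' = \<sigma> ` s2 U" "s3 U' = \<sigma> ` s3 U" "core U' = \<sigma> ` core U"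
  by (simp_all add: tri_img_def core_def image_Un)

lemma sub: "s1 U \<subseteq> tset U" "s2 U \<subseteq> tset U" "s3 U \<subseteq> tset U" "core U \<subseteq> tset U"
  "core_cnbhd U E v \<subseteq> tset U" "twin_class U E v \<subseteq> tset U" "tufted U E \<subseteq> tset U"
  by (auto simp: tset_def core_def core_cnbhd_def twin_class_def tufted_def)

text \<open>Injectivity is available on \<open>tset U\<close> only, so every set that is intersected
  or compared after relabelling must first be located inside \<open>tset U\<close>.\<close>

lemma img_Int: "A \<subseteq> tset U \<Longrightarrow> B \<subseteq> tset U \<Longrightarrow> \<sigma> ` A \<inter> \<sigma> ` B = \<sigma> ` (A \<inter> B)"
  using inj_on_image_Int[OF inj] by blast

lemma img_eq: "A \<subseteq> tset U \<Longrightarrow> B \<subseteq> tset U \<Longrightarrow> \<sigma> ` A = \<sigma> ` B \<longleftrightarrow> A = B"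
  using inj_on_image_eq_iff[OF inj] by blast

lemma nbhd_sub: "nbhd E v \<subseteq> tset U"
  using graph_on_nbhd[OF gr] by blast

lemma edge_img:
  assumes "u \<in> tset U" "v \<in> tset U"
  shows "{\<sigma> u, \<sigma> v} \<in> E' \<longleftrightarrow> {u, v} \<in> E"
proof
  assume "{\<sigma> u, \<sigma> v} \<in> E'"
  then obtain e where e: "e \<in> E" "\<sigma> ` {u, v} = \<sigma> ` e" by auto
  moreover have "e \<subseteq> tset U" using e gr by (simp add: graph_on_def)
  ultimately have "{u, v} = e" using img_eq[of "{u, v}" e] assms by simp
  then show "{u, v} \<in> E" using e by simp
next
  assume "{u, v} \<in> E"
  then have "\<sigma> ` {u, v} \<in> E'" by (rule imageI)
  then show "{\<sigma> u, \<sigma> v} \<in> E'" by simp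
qed

lemma nbhd_img:
  assumes "v \<in> tset U"
  shows "nbhd E' (\<sigma> v) = \<sigma> ` nbhd E v"
proof
  show "\<sigma> ` nbhd E v \<subseteq> nbhd E' (\<sigma> v)"
    using nbhd_sub[of v] edge_img[OF _ assms] by (auto simp: mem_nbhd[of _ E'] simp flip: mem_nbhd[of _ E])
  show "nbhd E' (\<sigma> v) \<subseteq> \<sigma> ` nbhd E v"
  proof
    fix x assume x: "x \<in> nbhd E' (\<sigma> v)"
    then obtain e where e: "e \<in> E" "{x, \<sigma> v} = \<sigma> ` e" by (auto simp: mem_nbhd)
    then obtain u where u: "u \<in> e" "x = \<sigma> u" by blast
    have "u \<in> tset U" using e u gr by (auto simp: graph_on_def)
    then have "u \<in> nbhd E v" using x u edge_img[OF _ assms] by (simp add: mem_nbhd)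
    then show "x \<in> \<sigma> ` nbhd E v" using u by simp
  qed
qed

lemma core_cnbhd_img:
  assumes "v \<in> core U"
  shows "core_cnbhd U' E' (\<sigma> v) = \<sigma> ` core_cnbhd U E v"
proof -
  have v: "v \<in> tset U" using assms sub by blast
  have "cnbhd E' (\<sigma> v) = \<sigma> ` cnbhd E v" using nbhd_img[OF v] by (simp add: cnbhd_def)
  moreover have "cnbhd E v \<subseteq> tset U" using nbhd_sub v by (simp add: cnbhd_def)
  ultimately show ?thesis using img_Int[OF _ sub(4)] by (simp add: core_cnbhd_def s_img)
qed

lemma core_cnbhd_img_eq: "u \<in> core U \<Longrightarrow> v \<in> core U \<Longrightarrow> core_cnbhd U' E' (\<sigma> u) = core_cnbhd U' E' (\<sigma> v) \<longleftrightarrow> core_cnbhd U E u = core_cnbhd U E v"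
  using core_cnbhd_img img_eq[OF sub(5,5)] by simp

lemma twin_class_img: "v \<in> core U \<Longrightarrow> twin_class U' E' (\<sigma> v) = \<sigma> ` twin_class U E v"
  using core_cnbhd_img_eq by (auto simp: twin_class_def s_img)

lemma leaves_img: "v \<in> core U \<Longrightarrow> nbhd E' (\<sigma> v) \<inter> s2 U' = \<sigma> ` (nbhd E v \<inter> s2 U)"
  using nbhd_img[of v] subsetD[OF sub(4)] img_Int[OF nbhd_sub sub(2)] by (simp add: s_img)

lemma tufted_img: "tufted U' E' = \<sigma> ` tufted U E"
  using leaves_img by (auto simp: tufted_def s_img(4))

text \<open>A leaf belongs to the block if and only if its neighbourhood meets the class, and
  injectivity preserves whether two sets meet.\<close>

lemma twin_block_img:
  assumes "v \<in> core U"
  shows "twin_block U' E' (\<sigma> v) = tri_img \<sigma> (twin_block U E v)"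
proof -
  have "(\<exists>c\<in>twin_class U' E' (\<sigma> v). c \<in> nbhd E' (\<sigma> y)) \<longleftrightarrow> (\<exists>c\<in>twin_class U E v. c \<in> nbhd E y)"
    if y: "y \<in> s2 U" for y
  proof -
    have y': "y \<in> tset U" using y sub by blast
    have "(\<exists>c\<in>twin_class U' E' (\<sigma> v). c \<in> nbhd E' (\<sigma> y)) \<longleftrightarrow> \<sigma> ` twin_class U E v \<inter> \<sigma> ` nbhd E y \<noteq> {}"
      using twin_class_img[OF assms] nbhd_img[OF y'] by auto
    also have "\<dots> \<longleftrightarrow> twin_class U E v \<inter> nbhd E y \<noteq> {}"
      using img_Int[OF sub(6) nbhd_sub] by simp
    finally show ?thesis by blast
  qed
  then have "{y \<in> s2 U'. \<exists>c\<in>twin_class U' E' (\<sigma> v). c \<in> nbhd E' y} = \<sigma> ` {y \<in> s2 U. \<exists>c\<in>twin_class U E v. c \<in> nbhd E y}"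
    unfolding s_img(2) by blast
  then show ?thesis
    using img_Int[OF sub(1) sub(6)] img_Int[OF sub(3) sub(6)]
    by (simp add: twin_block_def twin_class_img[OF assms] s_img(1,3) tri_img_def[of \<sigma> "(_, _)"])
qed

lemma untufted_part_img:
  assumes "v \<in> core U"
  shows "untufted_part U' E' (\<sigma> v) = tri_img \<sigma> (untufted_part U E v)"
proof -
  have "\<sigma> ` (s1 U \<inter> twin_class U E v - tufted U E) = \<sigma> ` (s1 U \<inter> twin_class U E v) - \<sigma> ` tufted U E"
    using sub by (intro inj_on_image_set_diff[OF inj]) auto
  then show ?thesis
    using img_Int[OF sub(1) sub(6)] img_Int[OF sub(3) sub(6)]
    by (simp add: untufted_part_def twin_class_img[OF assms] s_img(1,3) tufted_img tri_img_def[of \<sigma> "(_, _)"])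
qed

lemma tufts_img:
  assumes "v \<in> core U"
  shows "tufts U' E' (\<sigma> v) = tri_img \<sigma> ` tufts U E v"
proof -
  have t: "tuft U' E' (\<sigma> x) = tri_img \<sigma> (tuft U E x)" if "x \<in> tufted U E" for x
    using leaves_img[of x] that by (simp add: tuft_def tufted_def tri_img_def[of \<sigma> "(_, _)"])
  have "tufts U' E' (\<sigma> v) = tuft U' E' ` \<sigma> ` (twin_class U E v \<inter> tufted U E)"
    using img_Int[OF sub(6,7)] by (simp add: tufts_def twin_class_img[OF assms] tufted_img)
  also have "\<dots> = tri_img \<sigma> ` tuft U E ` (twin_class U E v \<inter> tufted U E)"
    unfolding image_image using t by (intro image_cong) auto
  finally show ?thesis by (simp add: tufts_def)
qed

lemma decomp_img: "decomp U' E' = transMP \<sigma> (decomp U E)"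
proof -
  have "twin_block U' E' ` core U' = tri_img \<sigma> ` twin_block U E ` core U"
    unfolding s_img image_image using twin_block_img by (intro image_cong) auto
  moreover have "(\<lambda>(u, v). {twin_block U' E' u, twin_block U' E' v}) `
       {(u, v). u \<in> core U' \<and> v \<in> core U' \<and> {u, v} \<in> E' \<and> core_cnbhd U' E' u \<noteq> core_cnbhd U' E' v} =
     (`) (tri_img \<sigma>) ` (\<lambda>(u, v). {twin_block U E u, twin_block U E v}) `
       {(u, v). u \<in> core U \<and> v \<in> core U \<and> {u, v} \<in> E \<and> core_cnbhd U E u \<noteq> core_cnbhd U E v}"
    (is "_ ` ?S' = _ ` _ ` ?S")
  proof -
    have e: "{\<sigma> u, \<sigma> v} \<in> E' \<longleftrightarrow> {u, v} \<in> E" if "u \<in> core U" "v \<in> core U" for u v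
      using edge_img that sub(4) by blast
    \<comment> \<open>Relabelling maps the pairs of adjacent vertices in different classes onto
      those of the relabelled graph; it remains to map pairs of vertices to pairs of blocks.\<close>
    have "?S' = map_prod \<sigma> \<sigma> ` ?S"
    proof
      show "?S' \<subseteq> map_prod \<sigma> \<sigma> ` ?S"
      proof
        fix q assume "q \<in> ?S'"
        then obtain a b where h: "q = (a, b)" "a \<in> core U'" "b \<in> core U'" "{a, b} \<in> E'" "core_cnbhd U' E' a \<noteq> core_cnbhd U' E' b"
          by blast
        obtain u v where uv: "a = \<sigma> u" "b = \<sigma> v" "u \<in> core U" "v \<in> core U" using h(2,3) s_img(4) by blast
        then have "(u, v) \<in> ?S" using h(4,5) e[of u v] core_cnbhd_img_eq[of u v] by simp
        moreover have "q = map_prod \<sigma> \<sigma> (u, v)" using uv h(1) by simp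
        ultimately show "q \<in> map_prod \<sigma> \<sigma> ` ?S" by (rule rev_image_eqI)
      qed
      show "map_prod \<sigma> \<sigma> ` ?S \<subseteq> ?S'"
      proof
        fix q assume "q \<in> map_prod \<sigma> \<sigma> ` ?S"
        then obtain u v where uv: "q = (\<sigma> u, \<sigma> v)" "u \<in> core U" "v \<in> core U" "{u, v} \<in> E" "core_cnbhd U E u \<noteq> core_cnbhd U E v"
          by blast
        then show "q \<in> ?S'" using e[of u v] core_cnbhd_img_eq[of u v] s_img(4) by simp
      qed
    qed
    then show ?thesis unfolding image_image using twin_block_img
      by (simp only: image_image) (intro image_cong, auto)
  qed
  moreover have "(\<lambda>v. (twin_block U' E' v, (untufted_part U' E' v, tufts U' E' v))) ` core U' =
    (\<lambda>(B, s). (tri_img \<sigma> B, transP \<sigma> s)) ` (\<lambda>v. (twin_block U E v, (untufted_part U E v, tufts U E v))) ` core U"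
    unfolding s_img image_image using twin_block_img untufted_part_img tufts_img by (intro image_cong) auto
  ultimately show ?thesis unfolding decomp_def by simp
qed

end

text \<open>An equality of virtual species means a natural isomorphism once the subtracted terms
  have been moved to the other side. The isomorphism passes through the graphs described by
  \<open>patch_graph\<close>: a structure on the left is turned into its graph, which is then
  decomposed into patches.\<close>

theorem theorem3p4:
  "\<exists>\<phi> :: 'a tri \<Rightarrow> 'a lhs_str \<Rightarrow> 'a MP_str.
     (\<forall>U. tri_ok U \<longrightarrow> bij_betw (\<phi> U) (LHS_sp U) (MP_sp U)) \<and>
     (\<forall>U \<sigma>. tri_ok U \<longrightarrow> inj_on \<sigma> (tset U) \<longrightarrow>
        (\<forall>s\<in>LHS_sp U. \<phi> (tri_img \<sigma> U) (transL \<sigma> s) = transMP \<sigma> (\<phi> U s)))"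
proof (intro exI[of _ "\<lambda>U s. decomp U (lhs_graph U s)"] conjI allI impI ballI)
  fix U :: "'a tri" assume "tri_ok U"
  then show "bij_betw (\<lambda>s. decomp U (lhs_graph U s)) (LHS_sp U) (MP_sp U)"
    using bij_betw_trans[OF bij_betw_lhs_graph bij_betw_decomp] by (simp add: comp_def)
next
  fix U :: "'a tri" and \<sigma> :: "'a \<Rightarrow> 'a" and s assume h: "tri_ok U" "inj_on \<sigma> (tset U)" "s \<in> LHS_sp U"
  have "patch_graph U (lhs_graph U s)" using bij_betwE[OF bij_betw_lhs_graph[OF h(1)]] h(3) by blast
  then interpret relabelled U "lhs_graph U s" \<sigma>
    using h(2) by unfold_locales (auto simp: patch_graph_def connected_graph_def)
  show "decomp (tri_img \<sigma> U) (lhs_graph (tri_img \<sigma> U) (transL \<sigma> s)) = transMP \<sigma> (decomp U (lhs_graph U s))"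
    unfolding lhs_graph_transL by (rule decomp_img)
qed

end
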